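(* For every $n\ge 1$, the assignment $p_{n,\lambda}\cdot A^f\mapsto p_{n,\lambda'}\cdot B_f$, for $(f,\lambda)\in\mathcal F_n$, gives a well-defined bijection $\Phi:\mathcal{AF}_n\to\mathcal{BF}_n$, and for every $\pi\in\mathcal{AF}_n$ we have $\mathbf a(\Phi(\pi))=\mathbf b(\pi)$ and $\mathbf b(\Phi(\pi))=\mathbf a(\pi)$.
   Context: Dyck paths: a Dyck path of semilength $n$ is a lattice path from $(0,0)$ to $(n,n)$ with unit north steps $\mathsf N$ and east steps $\mathsf E$ that never goes below the line $y=x$; $\mathcal D(n)$ is the set of these. Row $j$ ($1\le j\le n$) is the strip $j-1\le y\le j$ and column $i$ is the strip $i-1\le x\le i$. For $\pi\in\mathcal D(n)$ let $x_j=x_j(\pi)$ be the $x$-coordinate of the north step of $\pi$ in row $j$, and $h_i=h_i(\pi)$ the $y$-coordinate of the east step of $\pi$ in column $i$ (the number of cells of column $i$ below $\pi$); set $h_0=0$. A path is determined by $(x_j)$ (weakly increasing, $0\le x_j\le j-1$) and equally by $(h_i)$ (weakly increasing, $i\le h_i\le n$). The area sequence is $a_j=(j-1)-x_j$ and the area is $\mathbf a(\pi)=\sum_j a_j$. The bounce points are $b_0=0$ and $b_k=h_{b_{k-1}+1}$ for $k\ge 1$, until $b_m=n$ (i.e. the bounce path goes north from $(b_{k-1},b_{k-1})$ until it meets an east step of $\pi$, then east to the diagonal). The bounce composition is $\alpha=(\alpha_1,\dots,\alpha_m)$ with $\alpha_k=b_k-b_{k-1}$, and for a composition $\alpha$ of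 $n$ we write $p_{n,\alpha}=\mathsf N^{\alpha_1}\mathsf E^{\alpha_1}\cdots\mathsf N^{\alpha_m}\mathsf E^{\alpha_m}$ (this is the bounce path of $\pi$, and the bounce composition of $p_{n,\alpha}$ is $\alpha$). The bounce is $\mathbf b(\pi)=\sum_{k=1}^{m}(n-b_k)$. Let $\mathcal C(n)=\{p_{n,\alpha}:\alpha\text{ a composition of }n\}$. Operators: let $\mathcal D^*(n)=\mathcal D(n)\cup\{\bot\}$. Operators act on the right and compose left to right ($\pi\cdot XY=(\pi\cdot X)\cdot Y$); every operator sends $\bot$ to $\bot$; $X^k$ is the $k$-fold application, $X^{-k}=(X^{-1})^k$, $X^0$ the identity. $A_i$ replaces $x_i$ by $x_i-1$ (adds a cell to the left of the path in row $i$), $A_i^{-1}$ replaces $x_i$ by $x_i+1$; $C_i$ replaces $h_i$ by $h_i+1$ (adds a cell on top of the path in column $i$), $C_i^{-1}$ replaces $h_i$ by $h_i-1$; in each case the result is $\bot$ if the new sequence does not correspond to a Dyck path. For $\pi$ with bounce points $b_0,\dots,b_m$ and $1\le i\le m-1$, let $s=b_{i+1}-h_{b_i}$; then $\pi\cdot S_i=\bot$ if $h_{b_{i-1}}=b_i$, and otherwise $\pi\cdot S_i=\pi\cdot A_{b_i}^{-s}C_{b_i}^{s}$ ($S_i=\bot$ if $i\ge m$). In products of $S$'s each factor is computed with the bounce points of the path it is applied to. For $\pi$ with bounce composition $\alpha$ of length $\ell$, $1\le i<\ell$ and an integer $k\ge0$: let $c_j=\max\{0,\alpha_i-\alpha_{i+j}\}$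 for $1\le j\le \ell-i$, let $m$ be the largest integer with $0\le m\le \ell-i$ and $\sum_{j=1}^m c_j\le k$, and $d=k-\sum_{j=1}^m c_j$; then $\pi\cdot B_{i,k}=\pi\cdot S_i^{c_1}S_{i+1}^{c_2}\cdots S_{i+m-1}^{c_m}S_{i+m}^{d}$. Partitions: $\mathrm{Par}_n$ is the set of partitions of $n$; $\lambda'$ is the conjugate partition; $\bar\lambda$ is the strictly decreasing sequence of distinct parts of $\lambda$ (so $\bar\lambda_i$ is the $i$-th largest distinct part), $\ell(\bar\lambda)$ the number of distinct parts (note $\ell(\bar\lambda)=\ell(\bar{\lambda'})$), and $m_\lambda(j)$ the multiplicity of $j$ as a part of $\lambda$. With $\ell=\ell(\bar\lambda)$ define $\mathcal I_{bnc}(\lambda)=\{(i,r):1\le i\le\ell-1,\ 1\le r\le m_\lambda(\bar\lambda_{\ell-i})\}$, $\mathcal I_{row}(\lambda)=\{(i,r):1\le i\le \ell-1,\ 1\le r\le\bar\lambda_{i+1}\}$, $\mathrm{bnc}_\lambda(i,r)=1-r+\sum_{j=1}^{\ell-i}m_\lambda(\bar\lambda_j)$, $\mathrm{row}_\lambda(i,r)=r+\sum_{j=1}^{i}m_\lambda(\bar\lambda_j)\bar\lambda_j$. A count map is a function from such an index set to the nonnegative integers. For $\lambda\in\mathrm{Par}_n$ and a count map $f$ on $\mathcal I_{bnc}(\lambda')$ (a subset of $\mathcal I_{row}(\lambda)$), set $p_{n,\lambda}\cdot A^f=p_{n,\lambda}\cdot\prod_{(i,r)}A_{\mathrm{row}_\lambda(i,r)}^{f(i,r)}$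 and $p_{n,\lambda'}\cdot B_f=p_{n,\lambda'}\cdot\prod_{(i,r)}B_{\mathrm{bnc}_{\lambda'}(i,r),f(i,r)}$, the products over $(i,r)\in\mathcal I_{bnc}(\lambda')$ ordered left to right by $i$ ascending, then $r$ ascending. $\mathcal F_n$ is the set of pairs $(f,\lambda)$ with $\lambda\in\mathrm{Par}_n$, $\ell=\ell(\bar\lambda)$, $f$ a count map on $\mathcal I_{bnc}(\lambda')$ with $\bar\lambda_i>f(i,1)\ge f(i,2)\ge\cdots\ge f(i,m_{\lambda'}(\bar{\lambda'}_{\ell-i}))$ for all $1\le i\le\ell-1$, and $p_{n,\lambda'}\cdot B_f\in\mathcal C(n)$. Then $\mathcal{AF}_n=\{p_{n,\lambda}\cdot A^f:(f,\lambda)\in\mathcal F_n\}$ and $\mathcal{BF}_n=\{p_{n,\lambda'}\cdot B_f:(f,\lambda)\in\mathcal F_n\}$. *)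

theory Defs
  imports "HOL-Library.FuncSet"
begin

section \<open>Dyck paths\<close>

datatype step = North | East

type_synonym path = "step list"

definition dyck :: "nat \<Rightarrow> path set" where
  "dyck n = {p. count_list p North = n \<and> count_list p East = n \<and>
     (\<forall>k\<le>length p. count_list (take k p) East \<le> count_list (take k p) North)}"

text \<open>The first argument of the two recursions is the current coordinate.\<close>

fun xs_from :: "nat \<Rightarrow> path \<Rightarrow> nat list" where
  "xs_from c [] = []"
| "xs_from c (North # p) = c # xs_from c p"
| "xs_from c (East # p) = xs_from (Suc c) p"

fun hs_from :: "nat \<Rightarrow> path \<Rightarrow> nat list" where
  "hs_from c [] = []"
| "hs_from c (North # p) = hs_from (Suc c) p"
| "hs_from c (East # p) = c # hs_from c p"

definition xseq :: "path \<Rightarrow> nat list" where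
  "xseq p = xs_from 0 p"

definition hseq :: "path \<Rightarrow> nat list" where
  "hseq p = hs_from 0 p"

text \<open>Rows, columns, parts and bounce points are numbered from 1, as in the mathematics.\<close>

definition xc :: "path \<Rightarrow> nat \<Rightarrow> nat" where
  "xc p j = xseq p ! (j - 1)"

definition ht :: "path \<Rightarrow> nat \<Rightarrow> nat" where
  "ht p i = (if i = 0 then 0 else hseq p ! (i - 1))"

text \<open>For a Dyck path \<open>xc p j \<le> j - 1\<close>, so the subtraction does not truncate.\<close>

definition area :: "nat \<Rightarrow> path \<Rightarrow> nat" where
  "area n p = (\<Sum>j = 1..n. (j - 1) - xc p j)"

text \<open>
  The recursion does not stop by itself: the bounce points of a Dyck path of semilength \<open>n\<close> are
  the values at \<open>0, \<dots>, bounce_len n p\<close> only, and the later values carry no meaning.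
\<close>

primrec bounce_pt :: "path \<Rightarrow> nat \<Rightarrow> nat" where
  "bounce_pt p 0 = 0"
| "bounce_pt p (Suc k) = ht p (bounce_pt p k + 1)"

definition bounce_len :: "nat \<Rightarrow> path \<Rightarrow> nat" where
  "bounce_len n p = (LEAST m. bounce_pt p m = n)"

definition bounce_comp :: "nat \<Rightarrow> path \<Rightarrow> nat list" where
  "bounce_comp n p =
     map (\<lambda>k. bounce_pt p k - bounce_pt p (k - 1)) [1..<Suc (bounce_len n p)]"

definition bounce :: "nat \<Rightarrow> path \<Rightarrow> nat" where
  "bounce n p = (\<Sum>k = 1..bounce_len n p. n - bounce_pt p k)"

definition compositions :: "nat \<Rightarrow> nat list set" where
  "compositions n = {al. (\<forall>a\<in>set al. 0 < a) \<and> sum_list al = n}"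

definition comp_path :: "nat list \<Rightarrow> path" where
  "comp_path al = concat (map (\<lambda>a. replicate a North @ replicate a East) al)"

definition comp_paths :: "nat \<Rightarrow> path set" where
  "comp_paths n = comp_path ` compositions n"


section \<open>Operators\<close>

text \<open>
  \<open>None\<close> plays the role of \<open>\<bottom>\<close>.  Operators act on the right in the mathematics, so a product
  \<open>X Y\<close> applies \<open>X\<close> first; powers are iterates \<open>X ^^ k\<close>, and \<open>X\<close> to the power \<open>- k\<close> is the
  \<open>k\<close>-th iterate of the inverse operator.
\<close>

type_synonym path_op = "path option \<Rightarrow> path option"

definition lift_op :: "(path \<Rightarrow> path option) \<Rightarrow> path_op" where
  "lift_op F z = (case z of None \<Rightarrow> None | Some p \<Rightarrow> F p)"

definition op_prod :: "path_op list \<Rightarrow> path_op" where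
  "op_prod Xs z = fold (\<lambda>X. X) Xs z"

text \<open>Integer sequences, because a modified entry may be negative.\<close>

definition path_of_xs :: "nat \<Rightarrow> int list \<Rightarrow> path option" where
  "path_of_xs n xs =
     (if \<exists>p\<in>dyck n. map int (xseq p) = xs
      then Some (THE p. p \<in> dyck n \<and> map int (xseq p) = xs) else None)"

definition path_of_hs :: "nat \<Rightarrow> int list \<Rightarrow> path option" where
  "path_of_hs n hs =
     (if \<exists>p\<in>dyck n. map int (hseq p) = hs
      then Some (THE p. p \<in> dyck n \<and> map int (hseq p) = hs) else None)"

definition shift_row :: "nat \<Rightarrow> nat \<Rightarrow> int \<Rightarrow> path_op" where
  "shift_row n i t = lift_op (\<lambda>p.
     if 1 \<le> i \<and> i \<le> n
     then path_of_xs n ((map int (xseq p))[i - 1 := int (xc p i) + t]) else None)"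

definition shift_col :: "nat \<Rightarrow> nat \<Rightarrow> int \<Rightarrow> path_op" where
  "shift_col n i t = lift_op (\<lambda>p.
     if 1 \<le> i \<and> i \<le> n
     then path_of_hs n ((map int (hseq p))[i - 1 := int (ht p i) + t]) else None)"

definition A_op :: "nat \<Rightarrow> nat \<Rightarrow> path_op" where
  "A_op n i = shift_row n i (- 1)"

definition A_inv :: "nat \<Rightarrow> nat \<Rightarrow> path_op" where
  "A_inv n i = shift_row n i 1"

definition C_op :: "nat \<Rightarrow> nat \<Rightarrow> path_op" where
  "C_op n i = shift_col n i 1"

definition S_op :: "nat \<Rightarrow> nat \<Rightarrow> path_op" where
  "S_op n i = lift_op (\<lambda>p.
     let b = bounce_pt p; s = b (i + 1) - ht p (b i) in
     if 1 \<le> i \<and> i < bounce_len n p \<and> ht p (b (i - 1)) \<noteq> b i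
     then op_prod [A_inv n (b i) ^^ s, C_op n (b i) ^^ s] (Some p) else None)"

text \<open>
  The truncated subtraction in \<open>c\<close> is \<open>max {0, \<alpha>\<^sub>i - \<alpha>\<^sub>i\<^sub>+\<^sub>j}\<close>.  The operator is only
  meant for \<open>1 \<le> i < \<ell>\<close>, where \<open>\<ell>\<close> is the length of the bounce composition; elsewhere it is
  given the value \<open>\<bottom>\<close>.
\<close>

definition B_op :: "nat \<Rightarrow> nat \<Rightarrow> nat \<Rightarrow> path_op" where
  "B_op n i k = lift_op (\<lambda>p.
     let al = bounce_comp n p;
         l = length al;
         c = (\<lambda>j. al ! (i - 1) - al ! (i + j - 1));
         m = (GREATEST m. m \<le> l - i \<and> (\<Sum>j = 1..m. c j) \<le> k);
         d = k - (\<Sum>j = 1..m. c j)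
     in if 1 \<le> i \<and> i < l
        then op_prod (map (\<lambda>j. S_op n (i + j - 1) ^^ c j) [1..<Suc m] @ [S_op n (i + m) ^^ d])
               (Some p)
        else None)"


section \<open>Partitions\<close>

definition partitions :: "nat \<Rightarrow> nat list set" where
  "partitions n = {la. sorted_wrt (\<ge>) la \<and> (\<forall>a\<in>set la. 0 < a) \<and> sum_list la = n}"

definition conjugate :: "nat list \<Rightarrow> nat list" where
  "conjugate la =
     map (\<lambda>j. length (filter (\<lambda>a. j \<le> a) la)) [1..<Suc (Max (insert 0 (set la)))]"

text \<open>\<open>dpart la i\<close> is the \<open>i\<close>-th largest distinct part.\<close>

definition dpart :: "nat list \<Rightarrow> nat \<Rightarrow> nat" where
  "dpart la i = rev (sorted_list_of_set (set la)) ! (i - 1)"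

definition num_dparts :: "nat list \<Rightarrow> nat" where
  "num_dparts la = card (set la)"

definition I_bnc :: "nat list \<Rightarrow> (nat \<times> nat) set" where
  "I_bnc la = {(i, r). 1 \<le> i \<and> i \<le> num_dparts la - 1 \<and>
     1 \<le> r \<and> r \<le> count_list la (dpart la (num_dparts la - i))}"

definition I_bnc_list :: "nat list \<Rightarrow> (nat \<times> nat) list" where
  "I_bnc_list la = [(i, r). i \<leftarrow> [1..<num_dparts la],
     r \<leftarrow> [1..<Suc (count_list la (dpart la (num_dparts la - i)))]]"

lemma set_I_bnc_list: "set (I_bnc_list la) = I_bnc la"
proof -
  have "set (I_bnc_list la) =
      (\<Union>i\<in>{1..<num_dparts la}.
         Pair i ` {1..<Suc (count_list la (dpart la (num_dparts la - i)))})"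
    by (simp add: I_bnc_list_def del: upt_Suc)
  also have "\<dots> = I_bnc la"
    by (force simp: I_bnc_def)
  finally show ?thesis .
qed

definition bnc_idx :: "nat list \<Rightarrow> nat \<Rightarrow> nat \<Rightarrow> nat" where
  "bnc_idx la i r = 1 + (\<Sum>j = 1..num_dparts la - i. count_list la (dpart la j)) - r"

definition row_idx :: "nat list \<Rightarrow> nat \<Rightarrow> nat \<Rightarrow> nat" where
  "row_idx la i r = r + (\<Sum>j = 1..i. count_list la (dpart la j) * dpart la j)"

definition A_pow :: "nat \<Rightarrow> nat list \<Rightarrow> (nat \<times> nat \<Rightarrow> nat) \<Rightarrow> path option" where
  "A_pow n la f =
     op_prod (map (\<lambda>(i, r). A_op n (row_idx la i r) ^^ f (i, r)) (I_bnc_list (conjugate la)))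
       (Some (comp_path la))"

text \<open>The partition argument is \<open>\<lambda>\<close>; the path acted upon belongs to its conjugate.\<close>

definition B_sub :: "nat \<Rightarrow> nat list \<Rightarrow> (nat \<times> nat \<Rightarrow> nat) \<Rightarrow> path option" where
  "B_sub n la f =
     op_prod (map (\<lambda>(i, r). B_op n (bnc_idx (conjugate la) i r) (f (i, r)))
                (I_bnc_list (conjugate la)))
       (Some (comp_path (conjugate la)))"

definition F_set :: "nat \<Rightarrow> ((nat \<times> nat \<Rightarrow> nat) \<times> nat list) set" where
  "F_set n = {(f, la). la \<in> partitions n \<and> f \<in> I_bnc (conjugate la) \<rightarrow>\<^sub>E UNIV \<and>
     (\<forall>i. 1 \<le> i \<and> i \<le> num_dparts la - 1 \<longrightarrow>
        f (i, 1) < dpart la i \<and>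
        (\<forall>r. 1 \<le> r \<and>
             r < count_list (conjugate la) (dpart (conjugate la) (num_dparts la - i)) \<longrightarrow>
             f (i, r + 1) \<le> f (i, r))) \<and>
     B_sub n la f \<in> Some ` comp_paths n}"

definition AF :: "nat \<Rightarrow> path option set" where
  "AF n = {A_pow n la f | f la. (f, la) \<in> F_set n}"

definition BF :: "nat \<Rightarrow> path option set" where
  "BF n = {B_sub n la f | f la. (f, la) \<in> F_set n}"

end

theory Submission
  imports Defs "HOL-Library.Multiset"
begin

text \<open>
  On the \<open>A\<close> side, cells are added only to the first parts of the blocks of equal parts of \<open>\<lambda>\<close>, and
  too few of them to disturb the bounce path.  So the bounce composition of the result is \<open>\<lambda>\<close>, the
  values of \<open>f\<close> are read off the rows, and the area grows by the sum of \<open>f\<close>.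

  On the \<open>B\<close> side, an operator \<open>S\<^sub>i\<close> preserves the area and moves one unit from part \<open>i\<close> to part
  \<open>i + 1\<close> of the bounce composition (or acts as the identity).  The sum of the squares of the parts
  does not increase under any \<open>B\<^sub>i\<^sub>,\<^sub>k\<close>, whereas twice the area plus \<open>n\<close> bounds it from above, with
  equality exactly for the composition paths.  Hence, if the final path is a composition path, so
  are all intermediate ones, and every \<open>B\<^sub>i\<^sub>,\<^sub>k\<close> moves a part \<open>v\<close> to the right past parts \<open>u \<le> v\<close>
  with \<open>\<Sum>(v - u) = k\<close>.  This raises the bounce by \<open>k\<close>, and the multiset of the values \<open>f(i, -)\<close>
  is recovered from the final composition as the sums of \<open>v - u\<close> over the smaller parts \<open>u\<close>
  preceding each occurrence of \<open>v\<close>.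

  Finally, \<open>p\<^sub>n\<^sub>,\<^sub>\<lambda>\<close> has bounce \<open>\<Sum>(k - 1) \<lambda>\<^sub>k\<close>, which is the area of the path of the conjugate.
\<close>

section \<open>Coordinates of Dyck paths\<close>

text \<open>\<open>F_set\<close> constrains only the endpoint of the product of the B operators. On
  the way a path might leave the composition paths, where \<open>S_op\<close> can act as the
  identity and later factors become hard to predict, so a potential function replaces exact
  tracking. Moving d units from a part a to its right neighbour b lowers the sum of squares by 2d(a
  - b - d). This vanishes only if nothing moves or if d = a - b, that is, if the two parts are
  swapped. A block of size a has area a(a - 1)/2, which explains the value 2 area + n on composition
  paths. The area is preserved, so the potential agrees at both ends, and every factor must consist
  of swaps.

  Equal parts of a composition are indistinguishable, hence only a multiset of values of f(i, -) can
  be read off; monotonicity in r restores their order. On the A side the same monotonicity, with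
  f(i, 1) < \<open>dpart la i\<close>, provides the room for lowering the rows one after
  another.\<close>

lemma length_xs_from: "length (xs_from c p) = count_list p North"
  by (induction c p rule: xs_from.induct) auto

lemma length_hs_from: "length (hs_from c p) = count_list p East"
  by (induction c p rule: hs_from.induct) auto

lemma xs_from_ge: "x \<in> set (xs_from c p) \<Longrightarrow> c \<le> x"
  by (induction c p rule: xs_from.induct) auto

lemma hs_from_ge: "x \<in> set (hs_from c p) \<Longrightarrow> c \<le> x"
  by (induction c p rule: hs_from.induct) auto

lemma hs_from_le: "x \<in> set (hs_from c p) \<Longrightarrow> x \<le> c + count_list p North"
  by (induction c p rule: hs_from.induct) auto

text \<open>Both sides say that north step \<open>j\<close> precedes east step \<open>i\<close>,
  counted from 0. This Galois connection is the only link between the two descriptions of a path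
  that is used later.\<close>

lemma xs_from_hs_from_galois:
  "i < length (hs_from d p) \<Longrightarrow> j < length (xs_from c p) \<Longrightarrow>
    xs_from c p ! j \<le> c + i \<longleftrightarrow> d + j < hs_from d p ! i"
proof (induction p arbitrary: c d i j)
  case (Cons s p)
  show ?case
  proof (cases s)
    case North
    show ?thesis
    proof (cases j)
      case 0
      have "Suc d \<le> hs_from (Suc d) p ! i"
        using Cons.prems North by (intro hs_from_ge[of _ "Suc d" p] nth_mem) simp
      then show ?thesis using North 0 by simp
    next
      case (Suc j')
      then show ?thesis using Cons.IH[of i "Suc d" j' c] Cons.prems North by simp
    qed
  next
    case East
    show ?thesis
    proof (cases i)
      case 0
      have "Suc c \<le> xs_from (Suc c) p ! j"
        using Cons.prems East by (intro xs_from_ge[of _ "Suc c" p] nth_mem) simp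
      then show ?thesis using East 0 by simp
    next
      case (Suc i')
      then show ?thesis using Cons.IH[of i' d j "Suc c"] Cons.prems East by simp
    qed
  qed
qed simp

lemma all_le_Suc_split: "(\<forall>k\<le>Suc n. P k) \<longleftrightarrow> P 0 \<and> (\<forall>k\<le>n. P (Suc k))"
  by (metis Suc_le_mono not0_implies_Suc zero_le)

text \<open>Only an east step can violate the prefix condition, so it suffices to test it there.
  \<open>e\<close> is the number of east steps already taken, and \<open>e \<le> c\<close> is the
  case of the empty prefix.\<close>

lemma prefix_condition_iff_hs_from:
  "(\<forall>k\<le>length p. e + count_list (take k p) East \<le> c + count_list (take k p) North) \<longleftrightarrow>
   e \<le> c \<and> (\<forall>i<length (hs_from c p). e + i + 1 \<le> hs_from c p ! i)"
proof (induction p arbitrary: c e)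
  case (Cons s p)
  show ?case
  proof (cases s)
    case North
    then show ?thesis
      using Cons.IH[of e "Suc c"] by (auto simp: all_le_Suc_split)
  next
    case East
    then show ?thesis
      using Cons.IH[of "Suc e" c] by (auto simp: all_le_Suc_split All_less_Suc2)
  qed
qed simp

lemma dyck_iff:
  "p \<in> dyck n \<longleftrightarrow>
    length (xseq p) = n \<and> length (hseq p) = n \<and> (\<forall>i\<in>{1..n}. i \<le> ht p i)"
proof -
  have "(\<forall>i<n. i + 1 \<le> hseq p ! i) \<longleftrightarrow> (\<forall>i\<in>{1..n}. i \<le> ht p i)"
  proof safe
    fix i assume *: "\<forall>i<n. i + 1 \<le> hseq p ! i" "i \<in> {1..n}"
    then show "i \<le> ht p i" using *(1)[rule_format, of "i - 1"] by (auto simp: ht_def)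
  next
    fix i assume *: "\<forall>i\<in>{1..n}. i \<le> ht p i" "i < n"
    then show "i + 1 \<le> hseq p ! i" using *(1)[rule_format, of "Suc i"] by (auto simp: ht_def)
  qed
  then show ?thesis
    using prefix_condition_iff_hs_from[of p 0 0]
    by (auto simp: dyck_def xseq_def hseq_def length_xs_from length_hs_from)
qed

lemma xc_less_iff_le_ht:
  assumes "length (xseq p) = n" "length (hseq p) = n" "i \<in> {1..n}" "j \<in> {1..n}"
  shows "xc p j < i \<longleftrightarrow> j \<le> ht p i"
proof -
  obtain i' j' where "i = Suc i'" "j = Suc j'" using assms by (cases i; cases j) auto
  then show ?thesis
    using xs_from_hs_from_galois[of i' 0 p j' 0] assms
    by (auto simp: xc_def ht_def xseq_def hseq_def)
qed

context
  fixes n p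
  assumes p: "p \<in> dyck n"
begin

lemma length_xseq: "length (xseq p) = n"
  and length_hseq: "length (hseq p) = n"
  using p by (auto simp: dyck_iff)

lemma dyck_galois: "i \<in> {1..n} \<Longrightarrow> j \<in> {1..n} \<Longrightarrow> xc p j < i \<longleftrightarrow> j \<le> ht p i"
  by (rule xc_less_iff_le_ht[OF length_xseq length_hseq])

lemma ht_ge: "i \<le> n \<Longrightarrow> i \<le> ht p i"
  using p by (cases "i = 0") (auto simp: dyck_iff)

lemma ht_le: "i \<le> n \<Longrightarrow> ht p i \<le> n"
  using hs_from_le[of _ 0 p] length_xseq length_hseq
  by (auto simp: ht_def hseq_def xseq_def length_xs_from)

lemma ht_mono:
  assumes "i \<le> k" "k \<le> n"
  shows "ht p i \<le> ht p k"
proof (cases "i = 0")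
  case False
  have "ht p i \<in> {1..n}" using assms False ht_ge[of i] ht_le[of i] by auto
  then show ?thesis
    using dyck_galois[of i "ht p i"] dyck_galois[of k "ht p i"] assms False by auto
qed (simp add: ht_def)

lemma xc_less: "j \<in> {1..n} \<Longrightarrow> xc p j < j"
  using dyck_galois[of j j] ht_ge[of j] by auto

lemma xc_mono:
  assumes "j \<le> k" "j \<in> {1..n}" "k \<in> {1..n}"
  shows "xc p j \<le> xc p k"
proof (rule ccontr)
  assume "\<not> xc p j \<le> xc p k"
  then show False
    using dyck_galois[of "Suc (xc p k)" j] dyck_galois[of "Suc (xc p k)" k] assms xc_less[of j]
    by auto
qed

end

section \<open>Rebuilding a path from its row sequence\<close>

fun path_from :: "nat \<Rightarrow> nat \<Rightarrow> nat list \<Rightarrow> path" where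
  "path_from c N [] = replicate (N - c) East"
| "path_from c N (x # xs) = replicate (x - c) East @ North # path_from x N xs"

text \<open>\<open>xs_from\<close> consumes an east step without emitting an entry. Here the
  matching east step is extracted from the run hidden in \<open>replicate\<close>.\<close>

lemma path_from_East:
  assumes "\<forall>x\<in>set xs. Suc c \<le> x" "Suc c \<le> N"
  shows "path_from c N xs = East # path_from (Suc c) N xs"
proof (cases xs)
  case Nil
  then show ?thesis using assms by (simp flip: replicate_Suc Suc_diff_Suc)
next
  case (Cons x ys)
  then have "x - c = Suc (x - Suc c)" using assms by auto
  then show ?thesis using Cons by simp
qed

lemma path_from_xs_from: "path_from c (c + count_list p East) (xs_from c p) = p"
proof (induction c p rule: xs_from.induct)
  case (3 c p)
  then show ?case using path_from_East[of "xs_from (Suc c) p" c] xs_from_ge[of _ "Suc c" p] by simp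
qed auto

lemma xs_from_replicate_East: "xs_from c (replicate k East @ p) = xs_from (c + k) p"
  by (induction k arbitrary: c) auto

lemma count_list_replicate: "count_list (replicate k x) y = (if x = y then k else 0)"
  by (induction k) auto

lemma xs_from_path_from:
  assumes "sorted (c # xs)"
  shows "xs_from c (path_from c N xs) = xs"
  using assms
proof (induction xs arbitrary: c)
  case Nil
  show ?case using xs_from_replicate_East[of c "N - c" "[]"] by simp
qed (auto simp: xs_from_replicate_East)

lemma count_East_path_from:
  assumes "sorted (c # xs)" "\<forall>x\<in>set (c # xs). x \<le> N"
  shows "count_list (path_from c N xs) East = N - c"
  using assms
  by (induction xs arbitrary: c) (auto simp: count_list_replicate count_list_append)

lemma dyck_eqI_xc:
  assumes "p \<in> dyck n" "q \<in> dyck n" "\<And>j. j \<in> {1..n} \<Longrightarrow> xc p j = xc q j"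
  shows "p = q"
proof -
  have "xseq p = xseq q"
  proof (rule nth_equalityI)
    fix k assume "k < length (xseq p)"
    then show "xseq p ! k = xseq q ! k"
      using assms(3)[of "Suc k"] length_xseq[OF assms(1)] by (simp add: xc_def)
  qed (simp add: length_xseq[OF assms(1)] length_xseq[OF assms(2)])
  then show ?thesis
    using path_from_xs_from[of 0 p] path_from_xs_from[of 0 q] assms(1,2)
    by (simp add: xseq_def dyck_def)
qed

lemma dyck_eqI_ht:
  assumes "p \<in> dyck n" "q \<in> dyck n" "\<And>i. i \<in> {1..n} \<Longrightarrow> ht p i = ht q i"
  shows "p = q"
proof (rule dyck_eqI_xc[OF assms(1,2)])
  fix j assume j: "j \<in> {1..n}"
  have "xc p j < i \<longleftrightarrow> xc q j < i" if "i \<in> {1..n}" for i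
    using dyck_galois[OF assms(1) that j] dyck_galois[OF assms(2) that j] assms(3)[OF that] by simp
  from this[of "Suc (xc p j)"] this[of "Suc (xc q j)"] show "xc p j = xc q j"
    using xc_less[OF assms(1) j] xc_less[OF assms(2) j] j by auto
qed

lemma ex_dyck_xseq:
  assumes "length xs = n" "sorted xs" "\<And>j. j < n \<Longrightarrow> xs ! j \<le> j"
  shows "\<exists>p\<in>dyck n. xseq p = xs"
proof -
  define p where "p = path_from 0 n xs"
  have le: "\<forall>x\<in>set (0 # xs). x \<le> n"
    using assms by (auto simp: in_set_conv_nth) (meson le_trans less_imp_le)
  have x: "xseq p = xs" unfolding xseq_def p_def using assms(2) by (intro xs_from_path_from) auto
  have h: "length (hseq p) = n"
    unfolding hseq_def p_def length_hs_from using assms(2) le by (subst count_East_path_from) auto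
  have "i \<le> ht p i" if "i \<in> {1..n}" for i
  proof -
    \<comment> \<open>At the diagonal cell the Galois connection turns \<open>x_i < i\<close> into
      the Dyck condition \<open>i \<le> h_i\<close>.\<close>
    have "xc p i < i" using assms(3)[of "i - 1"] that by (cases i) (auto simp: xc_def x)
    then show ?thesis using xc_less_iff_le_ht[of p n i i] that assms(1) x h by simp
  qed
  then show ?thesis using x h assms(1) by (auto simp: dyck_iff)
qed


section \<open>Row and column operators\<close>

lemma path_of_xs_eq_Some_iff:
  "path_of_xs n xs = Some q \<longleftrightarrow> q \<in> dyck n \<and> map int (xseq q) = xs"
proof -
  have uniq: "p = q" if "p \<in> dyck n" "q \<in> dyck n" "map int (xseq p) = map int (xseq q)" for p q
    using that by (intro dyck_eqI_xc[of p n q]) (auto simp: xc_def dest: map_injective)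
  have the: "(THE p. p \<in> dyck n \<and> map int (xseq p) = xs) = p"
    if "p \<in> dyck n" "map int (xseq p) = xs" for p
    using that by (blast intro: the_equality uniq)
  show ?thesis
    unfolding path_of_xs_def using the by (auto simp del: map_map)
qed

lemma path_of_hs_eq_Some_iff:
  "path_of_hs n hs = Some q \<longleftrightarrow> q \<in> dyck n \<and> map int (hseq q) = hs"
proof -
  have uniq: "p = q" if "p \<in> dyck n" "q \<in> dyck n" "map int (hseq p) = map int (hseq q)" for p q
    using that by (intro dyck_eqI_ht[of p n q]) (auto simp: ht_def dest: map_injective)
  have the: "(THE p. p \<in> dyck n \<and> map int (hseq p) = hs) = p"
    if "p \<in> dyck n" "map int (hseq p) = hs" for p
    using that by (blast intro: the_equality uniq)
  show ?thesis
    unfolding path_of_hs_def using the by (auto simp del: map_map)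
qed

lemma all_atLeast1_conv_less: "(\<forall>j\<in>{1..n}. P j) \<longleftrightarrow> (\<forall>k<n. P (Suc k))"
  by (metis Suc_le_eq Suc_pred' atLeastAtMost_iff le_simps(2) less_eq_Suc_le not_less_eq_eq One_nat_def zero_le)

lemma shift_row_eq_Some_iff:
  assumes "p \<in> dyck n"
  shows "shift_row n i t (Some p) = Some q \<longleftrightarrow> i \<in> {1..n} \<and> q \<in> dyck n \<and>
    (\<forall>j\<in>{1..n}. int (xc q j) = int (xc p j) + (if j = i then t else 0))"
proof -
  have "map int (xseq q) = (map int (xseq p))[i - 1 := int (xc p i) + t] \<longleftrightarrow>
    (\<forall>j\<in>{1..n}. int (xc q j) = int (xc p j) + (if j = i then t else 0))"
    if "q \<in> dyck n" "i \<in> {1..n}"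
    unfolding all_atLeast1_conv_less using that length_xseq[OF assms] length_xseq[OF that(1)]
    by (auto simp: list_eq_iff_nth_eq xc_def nth_list_update)
  then have "i \<in> {1..n} \<and> q \<in> dyck n \<and>
      map int (xseq q) = (map int (xseq p))[i - 1 := int (xc p i) + t] \<longleftrightarrow>
    i \<in> {1..n} \<and> q \<in> dyck n \<and>
      (\<forall>j\<in>{1..n}. int (xc q j) = int (xc p j) + (if j = i then t else 0))" by blast
  moreover have "shift_row n i t (Some p) = Some q \<longleftrightarrow> i \<in> {1..n} \<and> q \<in> dyck n \<and>
      map int (xseq q) = (map int (xseq p))[i - 1 := int (xc p i) + t]"
    by (auto simp: shift_row_def lift_op_def path_of_xs_eq_Some_iff)
  ultimately show ?thesis by simp
qed

lemma shift_col_eq_Some_iff: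
  assumes "p \<in> dyck n"
  shows "shift_col n i t (Some p) = Some q \<longleftrightarrow> i \<in> {1..n} \<and> q \<in> dyck n \<and>
    (\<forall>j\<in>{1..n}. int (ht q j) = int (ht p j) + (if j = i then t else 0))"
proof -
  have "map int (hseq q) = (map int (hseq p))[i - 1 := int (ht p i) + t] \<longleftrightarrow>
    (\<forall>j\<in>{1..n}. int (ht q j) = int (ht p j) + (if j = i then t else 0))"
    if "q \<in> dyck n" "i \<in> {1..n}"
    unfolding all_atLeast1_conv_less using that length_hseq[OF assms] length_hseq[OF that(1)]
    by (auto simp: list_eq_iff_nth_eq ht_def nth_list_update)
  then have "i \<in> {1..n} \<and> q \<in> dyck n \<and>
      map int (hseq q) = (map int (hseq p))[i - 1 := int (ht p i) + t] \<longleftrightarrow>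
    i \<in> {1..n} \<and> q \<in> dyck n \<and>
      (\<forall>j\<in>{1..n}. int (ht q j) = int (ht p j) + (if j = i then t else 0))" by blast
  moreover have "shift_col n i t (Some p) = Some q \<longleftrightarrow> i \<in> {1..n} \<and> q \<in> dyck n \<and>
      map int (hseq q) = (map int (hseq p))[i - 1 := int (ht p i) + t]"
    by (auto simp: shift_col_def lift_op_def path_of_hs_eq_Some_iff)
  ultimately show ?thesis by simp
qed

lemma lift_op_None [simp]: "lift_op F None = None"
  by (simp add: lift_op_def)

lemma shift_row_None [simp]: "shift_row n i t None = None"
  by (simp add: shift_row_def)

lemma shift_col_None [simp]: "shift_col n i t None = None"
  by (simp add: shift_col_def)

lemma A_inv_funpow_Some:
  assumes "p \<in> dyck n" "(A_inv n i ^^ s) (Some p) = Some q"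
  shows "q \<in> dyck n \<and> (\<forall>j\<in>{1..n}. xc q j = xc p j + (if j = i then s else 0))"
  using assms(2)
proof (induction s arbitrary: q)
  case (Suc s)
  then obtain r where r: "(A_inv n i ^^ s) (Some p) = Some r"
    by (cases "(A_inv n i ^^ s) (Some p)") (auto simp: A_inv_def)
  with Suc.IH[OF r] Suc.prems show ?case
    by (auto simp: A_inv_def shift_row_eq_Some_iff split: if_splits)
qed (use assms in auto)

lemma C_op_funpow_Some:
  assumes "p \<in> dyck n" "(C_op n i ^^ s) (Some p) = Some q"
  shows "q \<in> dyck n \<and> (\<forall>j\<in>{1..n}. ht q j = ht p j + (if j = i then s else 0))"
  using assms(2)
proof (induction s arbitrary: q)
  case (Suc s)
  then obtain r where r: "(C_op n i ^^ s) (Some p) = Some r"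
    by (cases "(C_op n i ^^ s) (Some p)") (auto simp: C_op_def)
  with Suc.IH[OF r] Suc.prems show ?case
    by (auto simp: C_op_def shift_col_eq_Some_iff split: if_splits)
qed (use assms in auto)

text \<open>Lowering an entry respects the upper bound of its row. Only negativity or falling below
  the previous row could make the result undefined, and the hypotheses exclude both.\<close>

lemma A_op_Some:
  assumes p: "p \<in> dyck n" and i: "i \<in> {1..n}" "0 < xc p i" "1 < i \<Longrightarrow> xc p (i - 1) < xc p i"
  shows "\<exists>q\<in>dyck n. A_op n i (Some p) = Some q \<and>
    (\<forall>j\<in>{1..n}. xc q j = xc p j - (if j = i then 1 else 0))"
proof -
  define xs where "xs = (xseq p)[i - 1 := xc p i - 1]"
  have l: "length xs = n" using length_xseq[OF p] by (simp add: xs_def)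
  have nth: "xs ! k = xc p (Suc k) - (if Suc k = i then 1 else 0)" if "k < n" for k
    using that i length_xseq[OF p] by (auto simp: xs_def xc_def nth_list_update)
  have "sorted xs"
  proof (unfold sorted_iff_nth_mono_less, safe)
    fix a b assume *: "a < b" "b < length xs"
    have "xc p (Suc a) \<le> xc p (Suc b)" using * l by (intro xc_mono[OF p]) auto
    moreover have "xc p (Suc a) < xc p (Suc b)" if "Suc b = i"
    proof -
      have "xc p (Suc a) \<le> xc p b" using * l by (intro xc_mono[OF p]) auto
      also have "\<dots> < xc p (Suc b)" using i(3) that * by auto
      finally show ?thesis .
    qed
    ultimately show "xs ! a \<le> xs ! b" using * l by (auto simp: nth)
  qed
  moreover have "xs ! j \<le> j" if "j < n" for j
    using nth[OF that] xc_less[OF p, of "Suc j"] that by auto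
  ultimately obtain q where q: "q \<in> dyck n" "xseq q = xs" using ex_dyck_xseq[OF l] by blast
  have *: "xc q j = xc p j - (if j = i then 1 else 0)" if "j \<in> {1..n}" for j
    using nth[of "j - 1"] that q by (auto simp: xc_def)
  have "A_op n i (Some p) = Some q"
    unfolding A_op_def using q i(1,2) * by (subst shift_row_eq_Some_iff[OF p]) (auto simp: of_nat_diff)
  then show ?thesis using q * by blast
qed

lemma A_op_funpow_Some:
  assumes p: "p \<in> dyck n" and i: "i \<in> {1..n}"
    and "t \<le> xc p i" "1 < i \<Longrightarrow> xc p (i - 1) + t \<le> xc p i"
  shows "\<exists>q\<in>dyck n. (A_op n i ^^ t) (Some p) = Some q \<and>
    (\<forall>j\<in>{1..n}. xc q j = xc p j - (if j = i then t else 0))"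
  using assms(3,4)
proof (induction t)
  case 0
  then show ?case using p by auto
next
  case (Suc t)
  have "t \<le> xc p i" "1 < i \<longrightarrow> xc p (i - 1) + t \<le> xc p i" using Suc.prems by auto
  then obtain r where r: "r \<in> dyck n" "(A_op n i ^^ t) (Some p) = Some r"
    "\<forall>j\<in>{1..n}. xc r j = xc p j - (if j = i then t else 0)" using Suc.IH by blast
  have "xc r (i - 1) < xc r i" if "1 < i"
  proof -
    have "i - 1 \<in> {1..n}" "i - 1 \<noteq> i" using that i by auto
    then show ?thesis using r(3) i Suc.prems that by auto
  qed
  with A_op_Some[OF r(1) i] r(3) i Suc.prems obtain q where
    "q \<in> dyck n" "A_op n i (Some r) = Some q"
    "\<forall>j\<in>{1..n}. xc q j = xc r j - (if j = i then 1 else 0)" by auto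
  then show ?case using r by (intro bexI[of _ q]) auto
qed


section \<open>Area\<close>

text \<open>The cells of the n by n square are split by the path: those below it are counted by
  columns, those to its left by rows.\<close>

lemma sum_ht_add_sum_xc:
  assumes p: "p \<in> dyck n"
  shows "(\<Sum>i = 1..n. ht p i) + (\<Sum>j = 1..n. xc p j) = n * n"
proof -
  have "(\<Sum>i = 1..n. ht p i) = (\<Sum>i = 1..n. \<Sum>j = 1..n. of_bool (xc p j < i))"
  proof (intro sum.cong refl)
    fix i assume i: "i \<in> {1..n}"
    have "{1..n} \<inter> {j. xc p j < i} = {1..ht p i}"
      using dyck_galois[OF p i] ht_le[OF p, of i] i by auto
    then show "ht p i = (\<Sum>j = 1..n. of_bool (xc p j < i))" by (simp add: sum_of_bool_eq)
  qed
  also have "\<dots> = (\<Sum>j = 1..n. \<Sum>i = 1..n. of_bool (xc p j < i))" by (rule sum.swap)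
  also have "\<dots> = (\<Sum>j = 1..n. n - xc p j)"
  proof (intro sum.cong refl)
    fix j assume j: "j \<in> {1..n}"
    have "{1..n} \<inter> {i. xc p j < i} = {Suc (xc p j)..n}" by auto
    then show "(\<Sum>i = 1..n. of_bool (xc p j < i)) = n - xc p j" by (simp add: sum_of_bool_eq)
  qed
  finally have "(\<Sum>i = 1..n. ht p i) + (\<Sum>j = 1..n. xc p j) = (\<Sum>j = 1..n. (n - xc p j) + xc p j)"
    by (simp add: sum.distrib)
  also have "\<dots> = (\<Sum>j = 1..n. n)" using xc_less[OF p] by (intro sum.cong refl) force
  finally show ?thesis by simp
qed

lemma area_add_sum_xc:
  assumes p: "p \<in> dyck n"
  shows "area n p + (\<Sum>j = 1..n. xc p j) = (\<Sum>j = 1..n. j - 1)"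
proof -
  have "area n p + (\<Sum>j = 1..n. xc p j) = (\<Sum>j = 1..n. (j - 1 - xc p j) + xc p j)"
    by (simp add: area_def sum.distrib)
  also have "\<dots> = (\<Sum>j = 1..n. j - 1)" using xc_less[OF p] by (intro sum.cong refl) force
  finally show ?thesis .
qed

lemma two_sum_ht_eq:
  assumes "p \<in> dyck n"
  shows "2 * (\<Sum>i = 1..n. ht p i) = 2 * area n p + n * n + n"
proof -
  have "2 * (\<Sum>j = 1..n. j - 1) + n = n * n" by (induction n) auto
  then show ?thesis using sum_ht_add_sum_xc[OF assms] area_add_sum_xc[OF assms] by linarith
qed


section \<open>Bounce points\<close>

lemma bounce_pt_Suc_bounds:
  assumes "p \<in> dyck n" "bounce_pt p k < n"
  shows "bounce_pt p k < bounce_pt p (Suc k)" "bounce_pt p (Suc k) \<le> n"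
  using ht_ge[OF assms(1), of "bounce_pt p k + 1"] ht_le[OF assms(1), of "bounce_pt p k + 1"] assms(2)
  by auto

text \<open>The \<open>LEAST\<close> needs a witness. Bounce points that never hit \<open>n\<close>
  would stay below \<open>n\<close> and still increase strictly forever.\<close>

lemma bounce_pt_bounce_len:
  assumes p: "p \<in> dyck n"
  shows "bounce_pt p (bounce_len n p) = n"
proof -
  have "\<exists>m. bounce_pt p m = n"
  proof (rule ccontr)
    assume *: "\<nexists>m. bounce_pt p m = n"
    have "bounce_pt p k < n \<and> k \<le> bounce_pt p k" for k
    proof (induction k)
      case 0
      then show ?case using * by (metis bounce_pt.simps(1) gr0I le_refl)
    next
      case (Suc k)
      then show ?case using bounce_pt_Suc_bounds[OF p, of k] *
        by (metis Suc_leI le_less_trans nat_less_le)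
    qed
    from this[of n] show False by linarith
  qed
  then show ?thesis unfolding bounce_len_def by (rule LeastI_ex)
qed

lemma bounce_pt_less_n:
  assumes p: "p \<in> dyck n" and "k < bounce_len n p"
  shows "bounce_pt p k < n"
  using assms(2)
proof (induction k)
  case 0
  have "bounce_pt p 0 \<noteq> n" using 0 unfolding bounce_len_def by (rule not_less_Least)
  then show ?case by simp
next
  case (Suc k)
  then have "bounce_pt p (Suc k) \<le> n" using bounce_pt_Suc_bounds(2)[OF p, of k] by (simp del: bounce_pt.simps)
  moreover have "bounce_pt p (Suc k) \<noteq> n"
    using Suc.prems unfolding bounce_len_def by (rule not_less_Least)
  ultimately show ?case by simp
qed

lemma bounce_pt_strict_mono:
  assumes p: "p \<in> dyck n" and "k < l" "l \<le> bounce_len n p"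
  shows "bounce_pt p k < bounce_pt p l"
  using assms(2,3)
proof (induction l)
  case (Suc l)
  then have "bounce_pt p l < bounce_pt p (Suc l)"
    using bounce_pt_less_n[OF p, of l] bounce_pt_Suc_bounds[OF p, of l] by simp
  then show ?case using Suc by (cases "k = l") auto
qed simp

lemma bounce_pt_mono:
  assumes "p \<in> dyck n" and "k \<le> l" "l \<le> bounce_len n p"
  shows "bounce_pt p k \<le> bounce_pt p l"
  using bounce_pt_strict_mono[OF assms(1), of k l] assms(2,3) by (cases "k = l") auto

lemma bounce_pt_le_n:
  assumes "p \<in> dyck n" "k \<le> bounce_len n p"
  shows "bounce_pt p k \<le> n"
  using bounce_pt_mono[OF assms(1), of k "bounce_len n p"] assms bounce_pt_bounce_len[OF assms(1)]
  by simp

text \<open>A certificate: a guessed sequence that obeys the bounce recursion and reaches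
  \<open>n\<close> first at \<open>m\<close> is the sequence of bounce points.\<close>

lemma bounce_pt_eqI:
  assumes "B 0 = 0" "B m = n" "\<And>k. k < m \<Longrightarrow> B k \<noteq> n"
    and "\<And>k. k < m \<Longrightarrow> ht p (B k + 1) = B (Suc k)"
  shows "bounce_len n p = m" and "\<And>k. k \<le> m \<Longrightarrow> bounce_pt p k = B k"
proof -
  show *: "bounce_pt p k = B k" if "k \<le> m" for k
    using that
  proof (induction k)
    case (Suc k)
    then show ?case using assms(4)[of k] by simp
  qed (simp add: assms(1))
  show "bounce_len n p = m"
    unfolding bounce_len_def
  proof (rule Least_equality)
    fix k assume "bounce_pt p k = n"
    then show "m \<le> k" using assms(3)[of k] *[of k] by (cases "k < m") auto
  qed (simp add: * assms)
qed

lemma length_bounce_comp: "length (bounce_comp n p) = bounce_len n p"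
  by (simp add: bounce_comp_def)

lemma nth_bounce_comp:
  "k < bounce_len n p \<Longrightarrow> bounce_comp n p ! k = bounce_pt p (Suc k) - bounce_pt p k"
  by (simp add: bounce_comp_def del: upt_Suc bounce_pt.simps)

lemma sum_list_take_bounce_comp:
  assumes p: "p \<in> dyck n" and "k \<le> bounce_len n p"
  shows "sum_list (take k (bounce_comp n p)) = bounce_pt p k"
  using assms(2)
proof (induction k)
  case (Suc k)
  then have "bounce_pt p k \<le> bounce_pt p (Suc k)" using bounce_pt_mono[OF p, of k "Suc k"] by simp
  then show ?case
    using Suc by (simp add: take_Suc_conv_app_nth length_bounce_comp nth_bounce_comp del: bounce_pt.simps(2))
qed simp

lemma bounce_comp_compositions:
  assumes p: "p \<in> dyck n"
  shows "bounce_comp n p \<in> compositions n"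
proof -
  have "0 < bounce_comp n p ! k" if "k < bounce_len n p" for k
    using bounce_pt_strict_mono[OF p, of k "Suc k"] that by (simp add: nth_bounce_comp del: bounce_pt.simps(2))
  moreover have "sum_list (bounce_comp n p) = n"
    using sum_list_take_bounce_comp[OF p, of "bounce_len n p"] bounce_pt_bounce_len[OF p]
    by (simp add: length_bounce_comp)
  ultimately show ?thesis
    by (auto simp: compositions_def in_set_conv_nth length_bounce_comp)
qed

lemma sum_take_less:
  assumes "\<forall>a\<in>set al. 0 < a" "k < length al"
  shows "sum_list (take k al) < sum_list (al :: nat list)"
proof -
  have "sum_list al = sum_list (take k al) + sum_list (drop k al)"
    by (metis append_take_drop_id sum_list_append)
  moreover have "drop k al = al ! k # drop (Suc k) al" using assms(2) by (rule Cons_nth_drop_Suc[symmetric])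
  moreover have "0 < al ! k" using assms by auto
  ultimately show ?thesis by simp
qed

lemma bounce_comp_eqI:
  assumes "al \<in> compositions n"
    and "\<And>k. k < length al \<Longrightarrow> ht p (sum_list (take k al) + 1) = sum_list (take (Suc k) al)"
  shows "bounce_comp n p = al"
proof -
  define B where "B k = sum_list (take k al)" for k
  have pos: "\<forall>a\<in>set al. 0 < a" and n: "sum_list al = n" using assms(1) by (auto simp: compositions_def)
  have ne: "B k \<noteq> n" if "k < length al" for k
    using sum_take_less[OF pos that] n by (simp add: B_def)
  have B: "B 0 = 0" "B (length al) = n" "\<And>k. k < length al \<Longrightarrow> ht p (B k + 1) = B (Suc k)"
    using n assms(2) by (simp_all add: B_def)
  note bounce_pt_eqI[OF B(1,2) ne B(3)]
  then show ?thesis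
    by (intro nth_equalityI)
      (auto simp: length_bounce_comp nth_bounce_comp B_def take_Suc_conv_app_nth simp del: bounce_pt.simps(2))
qed

text \<open>Each part is counted once for every part before it, so this is the sum of (k - 1) times
  part k.\<close>

fun comp_bounce :: "nat list \<Rightarrow> nat" where
  "comp_bounce [] = 0"
| "comp_bounce (a # al) = sum_list al + comp_bounce al"

lemma comp_bounce_eq_sum: "comp_bounce al = (\<Sum>k<length al. sum_list (drop (Suc k) al))"
  by (induction al) (simp_all add: sum.lessThan_Suc_shift del: sum.lessThan_Suc)

lemma bounce_eq_comp_bounce:
  assumes p: "p \<in> dyck n"
  shows "bounce n p = comp_bounce (bounce_comp n p)"
proof -
  let ?al = "bounce_comp n p"
  have "bounce n p = (\<Sum>k<bounce_len n p. n - bounce_pt p (Suc k))"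
    unfolding bounce_def by (rule sum.reindex_bij_witness[of _ Suc "\<lambda>k. k - 1"]) auto
  also have "\<dots> = (\<Sum>k<bounce_len n p. sum_list (drop (Suc k) ?al))"
  proof (intro sum.cong refl)
    fix k assume "k \<in> {..<bounce_len n p}"
    then have "sum_list (take (Suc k) ?al) = bounce_pt p (Suc k)"
      by (intro sum_list_take_bounce_comp[OF p]) simp
    moreover have "sum_list (take (Suc k) ?al) + sum_list (drop (Suc k) ?al) = n"
      using bounce_comp_compositions[OF p]
      by (metis (mono_tags, lifting) append_take_drop_id sum_list_append compositions_def mem_Collect_eq)
    ultimately show "n - bounce_pt p (Suc k) = sum_list (drop (Suc k) ?al)" by linarith
  qed
  finally show ?thesis by (simp add: comp_bounce_eq_sum length_bounce_comp)
qed


section \<open>Composition paths\<close>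

text \<open>The start \<open>c\<close> stands for the diagonal point (c, c), which lets the blocks
  be treated one at a time.\<close>

fun comp_hs :: "nat \<Rightarrow> nat list \<Rightarrow> nat list" where
  "comp_hs c [] = []"
| "comp_hs c (a # al) = replicate a (c + a) @ comp_hs (c + a) al"

fun comp_xs :: "nat \<Rightarrow> nat list \<Rightarrow> nat list" where
  "comp_xs c [] = []"
| "comp_xs c (a # al) = replicate a c @ comp_xs (c + a) al"

lemma hs_from_replicate:
  "hs_from c (replicate k North @ p) = hs_from (c + k) p"
  "hs_from c (replicate k East @ p) = replicate k c @ hs_from c p"
  by (induction k arbitrary: c) auto

lemma xs_from_replicate_North: "xs_from c (replicate k North @ p) = replicate k c @ xs_from c p"
  by (induction k arbitrary: c) auto

lemma hseq_comp_path: "hseq (comp_path al) = comp_hs 0 al"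
proof -
  have "hs_from c (comp_path al) = comp_hs c al" for c
    by (induction al arbitrary: c) (simp_all add: comp_path_def hs_from_replicate)
  then show ?thesis by (simp add: hseq_def)
qed

lemma xseq_comp_path: "xseq (comp_path al) = comp_xs 0 al"
proof -
  have "xs_from c (comp_path al) = comp_xs c al" for c
    by (induction al arbitrary: c)
      (simp_all add: comp_path_def xs_from_replicate_North xs_from_replicate_East)
  then show ?thesis by (simp add: xseq_def)
qed

lemma length_comp_hs: "length (comp_hs c al) = sum_list al"
  by (induction al arbitrary: c) auto

lemma length_comp_xs: "length (comp_xs c al) = sum_list al"
  by (induction al arbitrary: c) auto

lemma comp_hs_nth:
  "k < length al \<Longrightarrow> t < al ! k \<Longrightarrow>
    comp_hs c al ! (sum_list (take k al) + t) = c + sum_list (take (Suc k) al)"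
proof (induction al arbitrary: c k)
  case (Cons a al)
  then show ?case by (cases k) (auto simp: nth_append)
qed simp

lemma comp_xs_nth:
  "k < length al \<Longrightarrow> t < al ! k \<Longrightarrow>
    comp_xs c al ! (sum_list (take k al) + t) = c + sum_list (take k al)"
proof (induction al arbitrary: c k)
  case (Cons a al)
  then show ?case by (cases k) (auto simp: nth_append)
qed simp

lemma comp_hs_ge: "i < length (comp_hs c al) \<Longrightarrow> c + i < comp_hs c al ! i"
proof (induction al arbitrary: c i)
  case (Cons a al)
  show ?case
  proof (cases "i < a")
    case False
    then show ?thesis using Cons.IH[of "i - a" "c + a"] Cons.prems by (auto simp: nth_append)
  qed (simp add: nth_append)
qed simp

lemma ht_comp_path:
  assumes "k < length al" "t \<in> {1..al ! k}"
  shows "ht (comp_path al) (sum_list (take k al) + t) = sum_list (take (Suc k) al)"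
  using comp_hs_nth[of k al "t - 1" 0] assms by (cases t) (auto simp: ht_def hseq_comp_path)

lemma xc_comp_path:
  assumes "k < length al" "t \<in> {1..al ! k}"
  shows "xc (comp_path al) (sum_list (take k al) + t) = sum_list (take k al)"
  using comp_xs_nth[of k al "t - 1" 0] assms by (cases t) (auto simp: xc_def xseq_comp_path)

lemma comp_path_dyck: "al \<in> compositions n \<Longrightarrow> comp_path al \<in> dyck n"
  unfolding dyck_iff hseq_comp_path xseq_comp_path length_comp_hs length_comp_xs
proof safe
  fix i assume "al \<in> compositions n" "i \<in> {1..n}"
  then show "i \<le> ht (comp_path al) i"
    using comp_hs_ge[of "i - 1" 0 al] by (cases i) (auto simp: ht_def hseq_comp_path length_comp_hs compositions_def)
qed (auto simp: compositions_def)

lemma bounce_comp_comp_path: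
  assumes "al \<in> compositions n"
  shows "bounce_comp n (comp_path al) = al"
proof (rule bounce_comp_eqI[OF assms])
  fix k assume k: "k < length al"
  then have "0 < al ! k" using assms by (auto simp: compositions_def)
  then show "ht (comp_path al) (sum_list (take k al) + 1) = sum_list (take (Suc k) al)"
    using ht_comp_path[of k al 1] k by simp
qed

section \<open>Area of composition paths and sums of squares\<close>

definition sq_sum :: "nat list \<Rightarrow> nat" where
  "sq_sum al = (\<Sum>a\<leftarrow>al. a * a)"

lemma two_sum_list_comp_hs:
  "2 * sum_list (comp_hs c al) = sq_sum al + sum_list al * sum_list al + 2 * c * sum_list al"
  by (induction al arbitrary: c) (simp_all add: sq_sum_def sum_list_replicate algebra_simps)

lemma sum_ht_eq_sum_list:
  assumes "p \<in> dyck n"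
  shows "(\<Sum>i = 1..n. ht p i) = sum_list (hseq p)"
proof -
  have "(\<Sum>i = 1..n. ht p i) = (\<Sum>k<n. hseq p ! k)"
    by (rule sum.reindex_bij_witness[of _ Suc "\<lambda>k. k - 1"]) (auto simp: ht_def)
  then show ?thesis
    by (simp add: sum_list_sum_nth length_hseq[OF assms] atLeast0LessThan)
qed

lemma two_area_comp_path:
  assumes "al \<in> compositions n"
  shows "2 * area n (comp_path al) + n = sq_sum al"
  using two_sum_ht_eq[OF comp_path_dyck[OF assms]] sum_ht_eq_sum_list[OF comp_path_dyck[OF assms]]
    two_sum_list_comp_hs[of 0 al] assms
  by (simp add: hseq_comp_path compositions_def)

lemma index_in_block:
  assumes "i < sum_list (al :: nat list)"
  shows "\<exists>k<length al. \<exists>t<al ! k. i = sum_list (take k al) + t"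
  using assms
proof (induction al arbitrary: i)
  case (Cons a al)
  show ?case
  proof (cases "i < a")
    case True
    then show ?thesis by (intro exI[of _ 0]) auto
  next
    case False
    then have "i - a < sum_list al" using Cons.prems by simp
    then obtain k t where "k < length al" "t < al ! k" "i - a = sum_list (take k al) + t"
      using Cons.IH by blast
    then show ?thesis using False by (intro exI[of _ "Suc k"]) auto
  qed
qed simp

text \<open>On a block of the bounce path the height is constant and agrees with \<open>p\<close> in
  the first column of the block; to the right of that column the heights of \<open>p\<close> can
  only grow.\<close>

lemma ht_ge_ht_comp_path:
  assumes p: "p \<in> dyck n" and i: "i \<in> {1..n}"
  shows "ht (comp_path (bounce_comp n p)) i \<le> ht p i"
proof -
  let ?al = "bounce_comp n p"
  have "i - 1 < sum_list ?al"
    using bounce_comp_compositions[OF p] i by (auto simp: compositions_def)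
  then obtain k t where k: "k < length ?al" "t < ?al ! k" "i - 1 = sum_list (take k ?al) + t"
    using index_in_block by blast
  then have i': "i = sum_list (take k ?al) + Suc t" using i by (cases i) auto
  have l: "k < bounce_len n p" using k length_bounce_comp by metis
  have "ht (comp_path ?al) i = sum_list (take (Suc k) ?al)"
    unfolding i' using k by (intro ht_comp_path) auto
  also have "\<dots> = bounce_pt p (Suc k)" using l by (intro sum_list_take_bounce_comp[OF p]) simp
  also have "\<dots> = ht p (bounce_pt p k + 1)" by simp
  also have "\<dots> \<le> ht p i"
    using i i' sum_list_take_bounce_comp[OF p, of k] l by (intro ht_mono[OF p]) auto
  finally show ?thesis .
qed

text \<open>A path lies above its bounce path, and the two coincide as soon as they have equal area.\<close>

lemma comp_path_bounce_comp:
  assumes p: "p \<in> dyck n" and "sq_sum (bounce_comp n p) = 2 * area n p + n"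
  shows "comp_path (bounce_comp n p) = p"
proof -
  let ?q = "comp_path (bounce_comp n p)"
  have q: "?q \<in> dyck n" using comp_path_dyck[OF bounce_comp_compositions[OF p]] .
  have "(\<Sum>i = 1..n. ht ?q i) = (\<Sum>i = 1..n. ht p i)"
    using two_sum_ht_eq[OF p] two_sum_ht_eq[OF q] assms(2)
      two_area_comp_path[OF bounce_comp_compositions[OF p]] by linarith
  then have "ht ?q i = ht p i" if "i \<in> {1..n}" for i
    using that ht_ge_ht_comp_path[OF p]
    by (intro sum_mono_inv[of "ht ?q" "{1..n}" "ht p"]) auto
  then show ?thesis by (intro dyck_eqI_ht[OF q p])
qed


section \<open>The operators \<open>S\<^sub>i\<close>\<close>

lemma op_prod_Nil [simp]: "op_prod [] z = z"
  and op_prod_Cons [simp]: "op_prod (X # Xs) z = op_prod Xs (X z)"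
  by (simp_all add: op_prod_def)

lemma op_prod_append: "op_prod (Xs @ Ys) z = op_prod Ys (op_prod Xs z)"
  by (simp add: op_prod_def)

lemma funpow_None: "X None = None \<Longrightarrow> (X ^^ k) None = None" for X :: "'a option \<Rightarrow> 'a option"
  by (induction k) auto

lemma C_op_None [simp]: "C_op n i None = None"
  by (simp add: C_op_def)

lemma S_op_None [simp]: "S_op n i None = None"
  by (simp add: S_op_def)

text \<open>On a stuck path \<open>S\<^sub>i\<close> has shift amount \<open>s = 0\<close> and acts as the identity, while
  \<open>S\<^sub>i\<^sub>+\<^sub>1\<close> is undefined.\<close>

definition stuck :: "path \<Rightarrow> nat \<Rightarrow> bool" where
  "stuck p i \<longleftrightarrow> ht p (bounce_pt p i) = bounce_pt p (Suc i)"

text \<open>Heights are compared through the Galois connection, which is available only for rows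
  between 1 and \<open>n\<close>.\<close>

lemma nat_eqI_le:
  assumes "a \<le> n" "b \<le> n" "\<And>j. j \<in> {1..n} \<Longrightarrow> j \<le> a \<longleftrightarrow> j \<le> b"
  shows "a = (b :: nat)"
  using assms(3)[of a] assms(3)[of b] assms(1,2) by (cases "a = 0"; cases "b = 0") auto

text \<open>As many cells are added as removed, so the area is unchanged. If \<open>s > 0\<close>,
  the removed cells are the first \<open>s\<close> cells of row \<open>b i\<close>, beginning in
  column \<open>b (i - 1) + 1\<close>. The height of that column drops by one, and with it bounce
  point \<open>i\<close>. The added cells raise column \<open>b i\<close> to height
  \<open>b (i + 1)\<close>; this is the column where the bounce path now leaves its new point
  \<open>b i - 1\<close>, so bounce point \<open>i + 1\<close> stays in place.\<close>

lemma S_op_Some: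
  assumes p: "p \<in> dyck n" and S: "S_op n i (Some p) = Some q"
  defines "b \<equiv> bounce_pt p" and "L \<equiv> bounce_len n p"
  shows "1 \<le> i" "i < L" "\<not> stuck p (i - 1)" "q \<in> dyck n" "area n q = area n p"
    and "stuck p i \<Longrightarrow> q = p"
    and "\<not> stuck p i \<Longrightarrow> bounce_len n q = L"
    and "\<And>k. \<not> stuck p i \<Longrightarrow> k \<le> L \<Longrightarrow> bounce_pt q k = (if k = i then b i - 1 else b k)"
proof -
  define s where "s = b (i + 1) - ht p (b i)"
  have C: "1 \<le> i \<and> i < L \<and> ht p (b (i - 1)) \<noteq> b i \<and>
      (C_op n (b i) ^^ s) ((A_inv n (b i) ^^ s) (Some p)) = Some q"
    using S by (auto simp: S_op_def lift_op_def Let_def b_def s_def L_def split: if_splits)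
  then show i: "1 \<le> i" "i < L" and "\<not> stuck p (i - 1)"
    by (auto simp: stuck_def b_def simp del: bounce_pt.simps(2))
  obtain r where r: "(A_inv n (b i) ^^ s) (Some p) = Some r"
    using C by (cases "(A_inv n (b i) ^^ s) (Some p)") (auto simp: funpow_None)
  have rd: "r \<in> dyck n" and xr: "\<And>j. j \<in> {1..n} \<Longrightarrow> xc r j = xc p j + (if j = b i then s else 0)"
    using A_inv_funpow_Some[OF p r] by auto
  have qd: "q \<in> dyck n" and hq: "\<And>j. j \<in> {1..n} \<Longrightarrow> ht q j = ht r j + (if j = b i then s else 0)"
    using C_op_funpow_Some[OF rd] C r by auto
  show "q \<in> dyck n" by (rule qd)
  have b: "b (i - 1) < b i" "b i < b (i + 1)" "b (i + 1) \<le> n"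
    unfolding b_def using i bounce_pt_strict_mono[OF p] bounce_pt_le_n[OF p]
    by (auto simp: L_def simp del: bounce_pt.simps)
  have bS: "ht p (b k + 1) = b (Suc k)" for k by (simp add: b_def)
  have bi: "b i \<in> {1..n}" using b by simp
  have le: "ht p (b i) \<le> b (i + 1)"
    using ht_mono[OF p, of "b i" "b i + 1"] b bS[of i] by simp
  have stuck: "stuck p i \<longleftrightarrow> s = 0"
    using le by (auto simp: stuck_def s_def b_def simp del: bounce_pt.simps)
  show "area n q = area n p"
  proof -
    have "(\<Sum>j = 1..n. xc r j) = (\<Sum>j = 1..n. xc p j) + s"
      using bi by (simp add: xr sum.distrib)
    moreover have "(\<Sum>j = 1..n. ht q j) = (\<Sum>j = 1..n. ht r j) + s"
      using bi by (simp add: hq sum.distrib)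
    ultimately show ?thesis
      using area_add_sum_xc[OF p] area_add_sum_xc[OF rd] two_sum_ht_eq[OF rd] two_sum_ht_eq[OF qd]
      by linarith
  qed
  show "q = p" if "stuck p i"
  proof -
    have "r = p" using that xr stuck by (intro dyck_eqI_xc[OF rd p]) auto
    moreover have "q = r" using that hq stuck by (intro dyck_eqI_ht[OF qd rd]) auto
    ultimately show ?thesis by simp
  qed
  have B: "bounce_len n q = L" "\<And>k. k \<le> L \<Longrightarrow> bounce_pt q k = (if k = i then b i - 1 else b k)"
    if "\<not> stuck p i"
  proof -
    have s: "0 < s" using that stuck by simp
    have bpi: "ht p (b (i - 1) + 1) = b i" using bS[of "i - 1"] i by simp
    have le1: "ht p (b (i - 1)) \<le> b i"
      using ht_mono[OF p, of "b (i - 1)" "b (i - 1) + 1"] b bpi by simp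
    \<comment> \<open>This is where the proviso in \<open>S_op\<close> enters: column
      \<open>b (i - 1)\<close> is lower than \<open>b i\<close>, whereas the next column has height
      \<open>b i\<close>.\<close>
    have x: "xc p (b i) = b (i - 1)"
    proof -
      have "xc p (b i) < b (i - 1) + 1"
        using dyck_galois[OF p, of "b (i - 1) + 1" "b i"] bpi b by simp
      moreover have "\<not> xc p (b i) < b (i - 1)"
        using dyck_galois[OF p, of "b (i - 1)" "b i"] le1 C b by (cases "b (i - 1) = 0") auto
      ultimately show ?thesis by simp
    qed
    \<comment> \<open>Definedness of the row shifts gives this bound for free. It keeps the columns
      lowered by the row shifts strictly left of the column raised afterwards.\<close>
    have lt: "b (i - 1) + s < b i" using xc_less[OF rd bi] xr[OF bi] x by simp
    have out: "ht r c = ht p c" if c: "c \<in> {1..n}" "c \<le> b (i - 1) \<or> b (i - 1) + s < c" for c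
    proof (rule nat_eqI_le)
      fix j assume j: "j \<in> {1..n}"
      have "xc r j < c \<longleftrightarrow> xc p j < c" using xr[OF j] x c by auto
      then show "j \<le> ht r c \<longleftrightarrow> j \<le> ht p c"
        using dyck_galois[OF rd c(1) j] dyck_galois[OF p c(1) j] by simp
    qed (use c ht_le[OF p] ht_le[OF rd] in auto)
    have hr: "ht r (b (i - 1) + 1) = b i - 1"
    proof (rule nat_eqI_le)
      fix j assume j: "j \<in> {1..n}"
      have c: "b (i - 1) + 1 \<in> {1..n}" using b by simp
      have "xc r j < b (i - 1) + 1 \<longleftrightarrow> j \<le> b i - 1"
      proof (cases "j = b i")
        case True
        then show ?thesis using xr[OF j] x s bi by auto
      next
        case False
        then show ?thesis using xr[OF j] dyck_galois[OF p c j] bpi by auto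
      qed
      then show "j \<le> ht r (b (i - 1) + 1) \<longleftrightarrow> j \<le> b i - 1"
        using dyck_galois[OF rd c j] by simp
    qed (use b ht_le[OF rd] in auto)
    define B where "B k = (if k = i then b i - 1 else b k)" for k
    have 1: "B 0 = 0" using i by (simp add: B_def b_def)
    have 2: "B L = n" using i bounce_pt_bounce_len[OF p] by (simp add: B_def b_def L_def)
    have 3: "B k \<noteq> n" if "k < L" for k
      using bounce_pt_less_n[OF p, of k] that b by (auto simp: B_def b_def L_def)
    have 4: "ht q (B k + 1) = B (Suc k)" if k: "k < L" for k
    proof -
      have kn: "b k < n" using bounce_pt_less_n[OF p, of k] k by (simp add: b_def L_def)
      consider "k = i" | "Suc k = i" | "k < i - 1" | "k > i" by linarith
      then show ?thesis
      proof cases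
        case 1
        \<comment> \<open>Here \<open>B i + 1\<close> is \<open>b i - 1 + 1\<close>, the raised
          column itself.\<close>
        have "ht q (b i) = ht p (b i) + s" using hq[OF bi] out[OF bi] lt by simp
        then show ?thesis using 1 bi le by (simp add: B_def s_def)
      next
        case 2
        then have "k = i - 1" by simp
        then show ?thesis using hq[of "b k + 1"] kn hr lt s 2 by (simp add: B_def)
      next
        case 3
        have "b k < b (i - 1)"
          unfolding b_def using 3 i by (intro bounce_pt_strict_mono[OF p]) (auto simp: L_def)
        then show ?thesis
          using hq[of "b k + 1"] out[of "b k + 1"] kn 3 b bS[of k] by (auto simp: B_def)
      next
        case 4
        have "b i < b k"
          unfolding b_def using 4 k by (intro bounce_pt_strict_mono[OF p]) (auto simp: L_def)
        then show ?thesis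
          using hq[of "b k + 1"] out[of "b k + 1"] kn 4 b bS[of k] lt by (auto simp: B_def)
      qed
    qed
    show "bounce_len n q = L" by (rule bounce_pt_eqI(1)[of B, OF 1 2 3 4])
    show "\<And>k. k \<le> L \<Longrightarrow> bounce_pt q k = (if k = i then b i - 1 else b k)"
      using bounce_pt_eqI(2)[of B, OF 1 2 3 4] by (simp add: B_def)
  qed
  show "\<not> stuck p i \<Longrightarrow> bounce_len n q = L"
    and "\<And>k. \<not> stuck p i \<Longrightarrow> k \<le> L \<Longrightarrow> bounce_pt q k = (if k = i then b i - 1 else b k)"
    using B by auto
qed

text \<open>Position \<open>i\<close> of a composition is list index \<open>i - 1\<close>.\<close>

definition transfer :: "nat \<Rightarrow> nat \<Rightarrow> nat list \<Rightarrow> nat list" where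
  "transfer i c al = al[i - 1 := al ! (i - 1) - c, i := al ! i + c]"

lemma length_transfer [simp]: "length (transfer i c al) = length al"
  by (simp add: transfer_def)

lemma bounce_comp_S_op:
  assumes p: "p \<in> dyck n" and S: "S_op n i (Some p) = Some q" and "\<not> stuck p i"
  shows "bounce_comp n q = transfer i 1 (bounce_comp n p)"
proof (rule nth_equalityI)
  note S' = S_op_Some[OF p S]
  show l: "length (bounce_comp n q) = length (transfer i 1 (bounce_comp n p))"
    using S' assms(3) by (simp add: length_bounce_comp)
  fix k assume "k < length (bounce_comp n q)"
  then have k: "k < bounce_len n p" using l by (simp add: length_bounce_comp)
  have "bounce_pt p (i - 1) < bounce_pt p i" "bounce_pt p i < bounce_pt p (Suc i)"
    using S'(1,2) bounce_pt_strict_mono[OF p] by (auto simp del: bounce_pt.simps)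
  then show "bounce_comp n q ! k = transfer i 1 (bounce_comp n p) ! k"
    using k S'(1,2) S'(7,8)[OF assms(3)]
    by (auto simp: nth_bounce_comp transfer_def nth_list_update length_bounce_comp
        simp del: bounce_pt.simps)
qed

lemma transfer_transfer:
  assumes "1 \<le> i" "i < length al"
  shows "transfer i c (transfer i d al) = transfer i (d + c) al"
proof -
  have "i - 1 \<noteq> i" "i - 1 < length al" using assms by auto
  then show ?thesis
    using assms by (auto simp: transfer_def list_eq_iff_nth_eq nth_list_update)
qed

text \<open>Once the path is stuck at \<open>i\<close>, further applications change nothing. So
  fewer than \<open>c\<close> units arrive only if the result is stuck, and then a following
  operator at \<open>i + 1\<close> is undefined. This is what makes the incomplete case harmless
  later.\<close>

lemma S_op_funpow_Some:
  assumes p: "p \<in> dyck n" and S: "(S_op n i ^^ c) (Some p) = Some q" and c: "0 < c"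
  shows "1 \<le> i" "i < bounce_len n p" "\<not> stuck p (i - 1)" "q \<in> dyck n" "area n q = area n p"
    and "\<exists>d\<le>c. bounce_comp n q = transfer i d (bounce_comp n p) \<and> d < bounce_comp n p ! (i - 1) \<and>
      (d = c \<or> stuck q i) \<and> (d = 0 \<longrightarrow> q = p)"
proof -
  obtain c' where c': "c = Suc c'" using c by (cases c) auto
  have "S_op n i (Some p) \<noteq> None"
    using S unfolding c'
    by (cases "S_op n i (Some p)") (auto simp: funpow_None funpow_Suc_right simp del: funpow.simps(2))
  then obtain r where "S_op n i (Some p) = Some r" by auto
  note r = S_op_Some[OF p this]
  show i: "1 \<le> i" "i < bounce_len n p" "\<not> stuck p (i - 1)" by fact+
  have *: "q \<in> dyck n \<and> area n q = area n p \<and>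
    (\<exists>d\<le>c. bounce_comp n q = transfer i d (bounce_comp n p) \<and> (d = c \<or> stuck q i) \<and> (d = 0 \<longrightarrow> q = p))"
    using S
  proof (induction c arbitrary: q)
    case 0
    then show ?case using p by (auto simp: transfer_def)
  next
    case (Suc c)
    then obtain r where r: "(S_op n i ^^ c) (Some p) = Some r" and S: "S_op n i (Some r) = Some q"
      by (cases "(S_op n i ^^ c) (Some p)") auto
    from Suc.IH[OF r] obtain d where d: "r \<in> dyck n" "area n r = area n p" "d \<le> c"
      "bounce_comp n r = transfer i d (bounce_comp n p)" "d = c \<or> stuck r i" "d = 0 \<longrightarrow> r = p" by auto
    note S' = S_op_Some[OF d(1) S]
    show ?case
    proof (cases "stuck r i")
      case True
      then have "q = r" by (rule S')
      then show ?thesis using d True by (auto intro!: exI[of _ d])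
    next
      case False
      have "bounce_comp n q = transfer i (Suc d) (bounce_comp n p)"
        using bounce_comp_S_op[OF d(1) S False] d(4) i
        by (simp add: transfer_transfer length_bounce_comp)
      then show ?thesis using S' d False by (auto intro!: exI[of _ "Suc d"])
    qed
  qed
  then show q: "q \<in> dyck n" "area n q = area n p" by auto
  from * obtain d where d: "d \<le> c" "bounce_comp n q = transfer i d (bounce_comp n p)"
    "d = c \<or> stuck q i" "d = 0 \<longrightarrow> q = p" by auto
  \<comment> \<open>Part \<open>i\<close> of the result is again positive, which bounds
    \<open>d\<close>.\<close>
  have "i - 1 < bounce_len n p" using i by simp
  then have "bounce_comp n q ! (i - 1) \<in> set (bounce_comp n q)"
    using d(2) by (intro nth_mem) (simp add: length_bounce_comp)
  then have "0 < bounce_comp n q ! (i - 1)"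
    using bounce_comp_compositions[OF q(1)] by (auto simp: compositions_def)
  moreover have "bounce_comp n q ! (i - 1) = bounce_comp n p ! (i - 1) - d"
    using d(2) i by (simp add: transfer_def length_bounce_comp nth_list_update)
  ultimately show "\<exists>d\<le>c. bounce_comp n q = transfer i d (bounce_comp n p) \<and>
      d < bounce_comp n p ! (i - 1) \<and> (d = c \<or> stuck q i) \<and> (d = 0 \<longrightarrow> q = p)"
    using d by auto
qed


section \<open>The operators \<open>B\<^sub>i\<^sub>,\<^sub>k\<close>\<close>

text \<open>Recursive, so that an induction advances the position and the list of exponents
  together.\<close>

fun S_run :: "nat \<Rightarrow> nat \<Rightarrow> nat list \<Rightarrow> path_op" where
  "S_run n i [] z = z"
| "S_run n i (c # cs) z = S_run n (Suc i) cs ((S_op n i ^^ c) z)"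

lemma S_run_None [simp]: "S_run n i cs None = None"
  by (induction cs arbitrary: i) (auto simp: funpow_None)

lemma S_run_append: "S_run n i (cs @ ds) z = S_run n (i + length cs) ds (S_run n i cs z)"
  by (induction cs arbitrary: i z) auto

lemma op_prod_S_op_eq_S_run:
  "op_prod (map (\<lambda>j. S_op n (i + j - 1) ^^ c j) [1..<Suc m]) z = S_run n i (map c [1..<Suc m]) z"
proof (induction m)
  case (Suc m)
  have "[1..<Suc (Suc m)] = [1..<Suc m] @ [Suc m]" by (rule upt_Suc_append) simp
  with Suc show ?case by (simp add: op_prod_append S_run_append del: upt_Suc)
qed simp

text \<open>The exponents that occur in \<open>B\<^sub>i\<^sub>,\<^sub>k\<close>, where \<open>v\<close> is part \<open>i\<close> of the bounce composition
  and the last argument lists the later parts.  The last exponent is unconstrained when no part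
  is left, because the operator is then undefined unless the exponent is 0.\<close>

fun exponents :: "nat \<Rightarrow> nat list \<Rightarrow> nat list \<Rightarrow> bool" where
  "exponents v [] bs \<longleftrightarrow> True"
| "exponents v (c # cs) [] \<longleftrightarrow> cs = []"
| "exponents v (c # cs) (b # bs) \<longleftrightarrow>
     (if cs = [] then c = 0 \<or> c < v - b else c = v - b \<and> exponents v cs bs)"

lemma exponentsI:
  "ys = [] \<or> d = 0 \<or> d < v - hd ys \<Longrightarrow> exponents v (map (\<lambda>b. v - b) xs @ [d]) (xs @ ys)"
proof (induction xs)
  case Nil
  then show ?case by (cases ys) auto
qed auto

lemma B_op_eq_S_run:
  assumes "B_op n i k (Some p) = Some q" and al: "bounce_comp n p = xs @ v # bs" and i: "i = Suc (length xs)"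
  shows "\<exists>cs. S_run n i cs (Some p) = Some q \<and> exponents v cs bs \<and> sum_list cs = k"
proof -
  define c where "c j = (xs @ v # bs) ! (i - 1) - (xs @ v # bs) ! (i + j - 1)" for j
  define P where "P m \<longleftrightarrow> m \<le> length bs \<and> (\<Sum>j = 1..m. c j) \<le> k" for m
  define m where "m = Greatest P"
  define d where "d = k - (\<Sum>j = 1..m. c j)"
  have l: "length (xs @ v # bs) - i = length bs" using i by simp
  have B: "S_run n i (map c [1..<Suc m] @ [d]) (Some p) = Some q"
    using assms(1) unfolding B_op_def lift_op_def al Let_def l option.case c_def[symmetric]
      P_def[symmetric] m_def[symmetric] d_def[symmetric] op_prod_append op_prod_S_op_eq_S_run S_run_append
    by (simp split: if_splits del: upt_Suc)
  have P: "P m" unfolding m_def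
    by (rule GreatestI_nat[of P 0 "length bs"]) (auto simp: P_def)
  have max: "\<not> P (Suc m)"
    using Greatest_le_nat[of P "Suc m" "length bs"] by (auto simp: P_def m_def)
  have c: "c j = v - bs ! (j - 1)" if "1 \<le> j" for j
    using that i by (cases j) (simp_all add: c_def nth_append)
  have cs: "map c [1..<Suc m] = map (\<lambda>b. v - b) (take m bs)"
    using P by (intro nth_equalityI) (auto simp: c P_def simp del: upt_Suc)
  \<comment> \<open>Maximality of \<open>m\<close> says that the remainder \<open>d\<close> does not
    suffice for another complete step, unless no part is left.\<close>
  have "drop m bs = [] \<or> d = 0 \<or> d < v - hd (drop m bs)"
  proof (cases "m < length bs")
    case True
    then have "k < (\<Sum>j = 1..Suc m. c j)" using max by (simp add: P_def)
    then have "d < c (Suc m)" using P by (auto simp: d_def P_def)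
    then show ?thesis using True by (simp add: c hd_drop_conv_nth)
  qed simp
  then have "exponents v (map c [1..<Suc m] @ [d]) bs"
    unfolding cs using exponentsI[of "drop m bs" d v "take m bs"] by simp
  moreover have "sum_list (map c [1..<Suc m] @ [d]) = k"
    using P by (simp add: P_def d_def interv_sum_list_conv_sum_set_nat atLeastLessThanSuc_atLeastAtMost del: upt_Suc)
  ultimately show ?thesis using B by blast
qed

section \<open>Transfers between neighbouring parts and their effect on the squares\<close>

lemma transfer_append:
  "transfer (Suc (length xs)) d (xs @ a # b # bs) = xs @ (a - d) # (b + d) # bs"
  by (simp add: transfer_def nth_append list_update_append)

lemma sq_sum_simps [simp]:
  "sq_sum [] = 0" "sq_sum (a # al) = a * a + sq_sum al" "sq_sum (al @ be) = sq_sum al + sq_sum be"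
  by (simp_all add: sq_sum_def)

text \<open>The defect \<open>2 * d * (a - b - d)\<close> is the strictness test of the whole
  argument: it is 0 exactly for \<open>d = 0\<close> and for the swap \<open>d = a - b\<close>.
  Written additively because of truncated subtraction.\<close>

lemma square_transfer:
  assumes "d + b \<le> (a :: nat)"
  shows "(a - d) * (a - d) + (b + d) * (b + d) + 2 * d * (a - b - d) = a * a + b * b"
proof -
  obtain e where e: "a = d + b + e" using assms le_Suc_ex by blast
  show ?thesis unfolding e by (simp add: algebra_simps)
qed

text \<open>The exponents are computed from the original value \<open>v\<close>, while the current
  part \<open>a\<close> may differ from it. The last hypothesis is the invariant: a nonzero exponent
  comes next only if \<open>v\<close> has fully arrived, or else the path is stuck and the next
  operator is undefined. With \<open>v \<le> a\<close> a transfer never exceeds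
  \<open>a - b\<close>, so the squares cannot grow.\<close>

lemma S_run_sq_sum_le:
  assumes "p \<in> dyck n" "S_run n (Suc (length xs)) cs (Some p) = Some q"
    and "bounce_comp n p = xs @ a # bs" "exponents v cs bs"
    and "cs = [] \<or> hd cs = 0 \<or> v \<le> a \<or> stuck p (length xs)"
  shows "q \<in> dyck n \<and> area n q = area n p \<and> sq_sum (bounce_comp n q) \<le> sq_sum (bounce_comp n p)"
  using assms
proof (induction cs arbitrary: p xs a bs)
  case (Cons c cs)
  let ?i = "Suc (length xs)"
  obtain r where r: "(S_op n ?i ^^ c) (Some p) = Some r" and run: "S_run n (Suc ?i) cs (Some r) = Some q"
    using Cons.prems(2) by (cases "(S_op n ?i ^^ c) (Some p)") auto
  note pow = S_op_funpow_Some[OF Cons.prems(1) r]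
  have len: "bounce_len n p = Suc (length xs + length bs)"
    using Cons.prems(3) length_bounce_comp[of n p] by simp
  show ?case
  proof (cases bs)
    case Nil
    then have "c = 0" using pow(2) len by fastforce
    then show ?thesis using Nil Cons.prems r run by simp
  next
    case bs: (Cons b bs')
    show ?thesis
    proof (cases "c = 0")
      case True
      then have rp: "r = p" using r by simp
      show ?thesis
      proof (cases "cs = []")
        case True
        then show ?thesis using rp run Cons.prems(1) by simp
      next
        case False
        \<comment> \<open>A zero exponent that is not the last one means \<open>v - b = 0\<close>,
          so the next part is itself large enough.\<close>
        then have "v \<le> b" "exponents v cs bs'" using Cons.prems(4) bs True by auto
        then show ?thesis
          using Cons.IH[of p "xs @ [a]" b bs'] Cons.prems(1,3) run rp bs by simp
      qed
    next
      case False
      then have c: "0 < c" by simp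
      note pow = pow[OF c]
      have va: "v \<le> a" using Cons.prems(5) pow(3) c by simp
      obtain d where d: "d \<le> c" "bounce_comp n r = transfer ?i d (bounce_comp n p)"
        "d = c \<or> stuck r ?i" using pow(6) by auto
      have comp: "bounce_comp n r = xs @ (a - d) # (b + d) # bs'"
        using d(2) Cons.prems(3) bs by (simp add: transfer_append)
      have cv: "c \<le> v - b" using Cons.prems(4) bs c by (auto split: if_splits)
      have "d + b \<le> a" using cv va d(1) c by linarith
      then have le: "sq_sum (bounce_comp n r) \<le> sq_sum (bounce_comp n p)"
        using square_transfer[of d b a] comp Cons.prems(3) bs by simp
      show ?thesis
      proof (cases "cs = []")
        case True
        then show ?thesis using run le pow by simp
      next
        case False
        then have "c = v - b" "exponents v cs bs'" using Cons.prems(4) bs by auto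
        \<comment> \<open>A complete transfer lifts \<open>b\<close> to \<open>v\<close>; an
          incomplete one leaves a stuck path.\<close>
        moreover from this have "v \<le> b + d \<or> stuck r ?i" using d(3) by auto
        ultimately show ?thesis
          using Cons.IH[of r "xs @ [a - d]" "b + d" bs'] comp run le pow by auto
      qed
    qed
  qed
qed simp

text \<open>The sum of squares forces \<open>p\<close> to be a composition path, and there column
  \<open>b_i\<close>, the last one of its block, has height \<open>b_i\<close>, which is below the
  next bounce point.\<close>

lemma not_stuck_comp_path:
  assumes p: "p \<in> dyck n" and "sq_sum (bounce_comp n p) = 2 * area n p + n"
    and i: "1 \<le> i" "i < bounce_len n p"
  shows "\<not> stuck p i"
proof -
  let ?al = "bounce_comp n p"
  obtain k where k: "i = Suc k" using i by (cases i) auto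
  then have kl: "k < length ?al" using i by (simp add: length_bounce_comp)
  then have "0 < ?al ! k" using bounce_comp_compositions[OF p] by (auto simp: compositions_def)
  moreover have take: "sum_list (take i ?al) = sum_list (take k ?al) + ?al ! k"
    using kl k by (simp add: take_Suc_conv_app_nth)
  ultimately have "ht (comp_path ?al) (sum_list (take i ?al)) = sum_list (take i ?al)"
    using ht_comp_path[of k ?al "?al ! k"] kl k by simp
  then have "ht p (bounce_pt p i) = bounce_pt p i"
    using comp_path_bounce_comp[OF assms(1,2)] sum_list_take_bounce_comp[OF p, of i] i by simp
  then show ?thesis
    using bounce_pt_strict_mono[OF p, of i "Suc i"] i by (simp add: stuck_def del: bounce_pt.simps)
qed

text \<open>Since the squares may not drop, each nonzero exponent swaps \<open>v\<close> with its
  right neighbour. The swap makes \<open>v\<close> the current part again and keeps the path a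
  composition path, so the induction continues. A genuinely partial final transfer would lose
  squares.\<close>

lemma S_run_exact:
  assumes "p \<in> dyck n" "S_run n (Suc (length xs)) cs (Some p) = Some q"
    and "bounce_comp n p = xs @ v # bs" "exponents v cs bs" "\<forall>b\<in>set bs. b \<le> v"
    and "sq_sum (bounce_comp n p) = 2 * area n p + n"
    and "sq_sum (bounce_comp n q) = sq_sum (bounce_comp n p)"
  shows "\<exists>s1 s2. bs = s1 @ s2 \<and> bounce_comp n q = xs @ s1 @ v # s2 \<and> (\<Sum>u\<leftarrow>s1. v - u) = sum_list cs"
  using assms
proof (induction cs arbitrary: p xs bs)
  case (Cons c cs)
  let ?i = "Suc (length xs)"
  obtain r where r: "(S_op n ?i ^^ c) (Some p) = Some r" and run: "S_run n (Suc ?i) cs (Some r) = Some q"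
    using Cons.prems(2) by (cases "(S_op n ?i ^^ c) (Some p)") auto
  note pow = S_op_funpow_Some[OF Cons.prems(1) r]
  have len: "bounce_len n p = Suc (length xs + length bs)"
    using Cons.prems(3) length_bounce_comp[of n p] by simp
  show ?case
  proof (cases bs)
    case Nil
    then have "c = 0" using pow(2) len by fastforce
    then show ?thesis using Nil Cons.prems r run by simp
  next
    case bs: (Cons b bs')
    show ?thesis
    proof (cases "c = 0")
      case True
      then have rp: "r = p" using r by simp
      show ?thesis
      proof (cases "cs = []")
        case True
        then show ?thesis using rp run Cons.prems(3) \<open>c = 0\<close> by (intro exI[of _ "[]"] exI[of _ bs]) simp
      next
        case False
        \<comment> \<open>Passing an equal part costs nothing and leaves the composition unchanged,
          so \<open>b\<close> may be counted as passed.\<close>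
        then have vb: "v = b" "exponents v cs bs'" using Cons.prems(4,5) bs True by auto
        then obtain s1 s2 where "bs' = s1 @ s2" "bounce_comp n q = (xs @ [b]) @ s1 @ v # s2"
          "(\<Sum>u\<leftarrow>s1. v - u) = sum_list cs"
          using Cons.IH[of p "xs @ [b]" bs'] Cons.prems(1,3,5-) run rp bs by auto
        then show ?thesis using bs True vb by (intro exI[of _ "b # s1"] exI[of _ s2]) simp
      qed
    next
      case False
      then have c: "0 < c" by simp
      note pow = pow[OF c]
      obtain d where d: "d \<le> c" "bounce_comp n r = transfer ?i d (bounce_comp n p)"
        "d = c \<or> stuck r ?i" "d = 0 \<longrightarrow> r = p" using pow(6) by auto
      have comp: "bounce_comp n r = xs @ (v - d) # (b + d) # bs'"
        using d(2) Cons.prems(3) bs by (simp add: transfer_append)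
      have cv: "c \<le> v - b" using Cons.prems(4) bs c by (auto split: if_splits)
      have bv: "b \<le> v" using Cons.prems(5) bs by simp
      \<comment> \<open>With \<open>d = 0\<close> the path would be unchanged and stuck, but
        composition paths are never stuck here.\<close>
      have "d \<noteq> 0"
        using d(3,4) c not_stuck_comp_path[OF Cons.prems(1,6), of ?i] pow(2) by auto
      have "d + b \<le> v" using cv d(1) bv by linarith
      have sq: "sq_sum (bounce_comp n r) + 2 * d * (v - b - d) = sq_sum (bounce_comp n p)"
        using square_transfer[of d b v] \<open>d + b \<le> v\<close> comp Cons.prems(3) bs by simp
      have "sq_sum (bounce_comp n q) \<le> sq_sum (bounce_comp n r)"
      proof (cases "cs = []")
        case False
        then have "c = v - b" "exponents v cs bs'" using Cons.prems(4) bs by auto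
        moreover from this have "v \<le> b + d \<or> stuck r ?i" using d(3) by auto
        ultimately show ?thesis
          using S_run_sq_sum_le[of r n "xs @ [v - d]" cs q "b + d" bs' v] comp run pow by auto
      qed (use run in simp)
      then have "2 * d * (v - b - d) = 0" using sq Cons.prems(7) by linarith
      then have dv: "d = c" "c = v - b" using \<open>d \<noteq> 0\<close> cv d(1) by auto
      \<comment> \<open>A nonzero final exponent would be smaller than \<open>v - b\<close>, so a
        full swap cannot be the last factor.\<close>
      then have cs: "cs \<noteq> []" "exponents v cs bs'" using Cons.prems(4) bs c by (auto split: if_splits)
      have "bounce_comp n r = (xs @ [b]) @ v # bs'" using comp dv bv by simp
      moreover have "sq_sum (bounce_comp n r) = sq_sum (bounce_comp n p)" using sq dv by simp
      ultimately obtain s1 s2 where "bs' = s1 @ s2" "bounce_comp n q = (xs @ [b]) @ s1 @ v # s2"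
          "(\<Sum>u\<leftarrow>s1. v - u) = sum_list cs"
        using Cons.IH[of r "xs @ [b]" bs'] Cons.prems(5-) run cs pow bs by auto
      then show ?thesis using bs dv by (intro exI[of _ "b # s1"] exI[of _ s2]) simp
    qed
  qed
qed (auto intro: exI[of _ "[]"])

lemma B_op_None [simp]: "B_op n i k None = None"
  by (simp add: B_op_def)

lemma B_op_sq_sum_le:
  assumes p: "p \<in> dyck n" and B: "B_op n i k (Some p) = Some q"
  shows "q \<in> dyck n \<and> area n q = area n p \<and> sq_sum (bounce_comp n q) \<le> sq_sum (bounce_comp n p)"
proof -
  let ?al = "bounce_comp n p"
  have i: "1 \<le> i" "i < length ?al"
    using B by (auto simp: B_op_def lift_op_def Let_def split: if_splits)
  define xs where "xs = take (i - 1) ?al"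
  have al: "?al = xs @ ?al ! (i - 1) # drop i ?al" and ix: "i = Suc (length xs)"
    unfolding xs_def using i id_take_nth_drop[of "i - 1" ?al] by auto
  from B_op_eq_S_run[OF B al ix] show ?thesis
    using S_run_sq_sum_le[OF p _ al] ix by auto
qed

lemma B_op_exact:
  assumes "p \<in> dyck n" "B_op n (Suc (length xs)) k (Some p) = Some q"
    and "bounce_comp n p = xs @ v # bs" "\<forall>b\<in>set bs. b \<le> v"
    and "sq_sum (bounce_comp n p) = 2 * area n p + n"
    and "sq_sum (bounce_comp n q) = sq_sum (bounce_comp n p)"
  shows "\<exists>s1 s2. bs = s1 @ s2 \<and> bounce_comp n q = xs @ s1 @ v # s2 \<and> (\<Sum>u\<leftarrow>s1. v - u) = k"
proof -
  obtain cs where "S_run n (Suc (length xs)) cs (Some p) = Some q" "exponents v cs bs" "sum_list cs = k"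
    using B_op_eq_S_run[OF assms(2,3) refl] by blast
  with S_run_exact[OF assms(1) this(1) assms(3) this(2) assms(4-6)] show ?thesis by simp
qed


section \<open>Products of the operators \<open>B\<^sub>i\<^sub>,\<^sub>k\<close>\<close>

text \<open>For every occurrence of \<open>w\<close>, the sum of \<open>w - u\<close> over the preceding smaller parts \<open>u\<close>;
  larger parts contribute 0 by truncated subtraction.\<close>

fun drops_from :: "nat \<Rightarrow> nat \<Rightarrow> nat list \<Rightarrow> nat multiset" where
  "drops_from w s [] = {#}"
| "drops_from w s (u # us) = (if u = w then {#s#} else {#}) + drops_from w (s + (w - u)) us"

abbreviation drops :: "nat \<Rightarrow> nat list \<Rightarrow> nat multiset" where
  "drops w al \<equiv> drops_from w 0 al"

lemma drops_from_append:
  "drops_from w s (xs @ ys) = drops_from w s xs + drops_from w (s + (\<Sum>u\<leftarrow>xs. w - u)) ys"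
  by (induction xs arbitrary: s) (auto simp: add.assoc)

lemma drops_from_notin: "w \<notin> set xs \<Longrightarrow> drops_from w s xs = {#}"
  by (induction xs arbitrary: s) auto

text \<open>For \<open>w \<le> v\<close> the new part contributes \<open>w - v = 0\<close> to the
  sums belonging to \<open>w\<close>; for \<open>v < w\<close> no \<open>w\<close> occurs at
  all.\<close>

lemma drops_insert:
  assumes "\<forall>u\<in>set (s1 @ s2). u \<le> v"
  shows "drops w (s1 @ v # s2) = drops w (s1 @ s2) + (if v = w then {#\<Sum>u\<leftarrow>s1. v - u#} else {#})"
proof (cases "w \<le> v")
  case False
  then have "w \<notin> set (s1 @ v # s2)" using assms by auto
  then show ?thesis using False drops_from_notin[of w "s1 @ s2"] drops_from_notin[of w "s1 @ v # s2"] by simp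
qed (simp add: drops_from_append)

lemma comp_bounce_append:
  "comp_bounce (xs @ ys) = comp_bounce xs + length xs * sum_list ys + comp_bounce ys"
  by (induction xs) auto

text \<open>Every pair of positions contributes its later part. When \<open>v\<close> passes
  \<open>u\<close>, the contribution of this pair changes from \<open>u\<close> to
  \<open>v\<close>.\<close>

lemma comp_bounce_move:
  assumes "\<forall>u\<in>set s1. u \<le> v"
  shows "comp_bounce (ps @ s1 @ v # s2) = comp_bounce (ps @ v # s1 @ s2) + (\<Sum>u\<leftarrow>s1. v - u)"
proof -
  have "sum_list s1 + (\<Sum>u\<leftarrow>s1. v - u) = length s1 * v"
    using assms by (induction s1) auto
  then show ?thesis by (simp add: comp_bounce_append algebra_simps)
qed

abbreviation B_prod :: "nat \<Rightarrow> (nat \<times> nat) list \<Rightarrow> path_op" where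
  "B_prod n zs \<equiv> op_prod (map (\<lambda>(i, k). B_op n i k) zs)"

lemma B_prod_None: "B_prod n zs None = None"
  by (induction zs) auto

lemma B_prod_sq_sum_le:
  assumes "p \<in> dyck n" "B_prod n zs (Some p) = Some q"
  shows "q \<in> dyck n \<and> area n q = area n p \<and> sq_sum (bounce_comp n q) \<le> sq_sum (bounce_comp n p)"
  using assms
proof (induction zs arbitrary: p)
  case (Cons z zs)
  obtain i k where z: "z = (i, k)" by force
  then obtain r where r: "B_op n i k (Some p) = Some r" and "B_prod n zs (Some r) = Some q"
    using Cons.prems by (cases "B_op n i k (Some p)") (auto simp: B_prod_None)
  with B_op_sq_sum_le[OF Cons.prems(1) r] Cons.IH[of r] show ?case by auto
qed simp

text \<open>\<open>ps\<close> holds the parts still to be moved and \<open>\<sigma>\<close> those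
  already rearranged. The last element of \<open>ps\<close> dominates \<open>\<sigma>\<close>, so
  inserting it adds one entry to the drops of its own value and disturbs no other drop.\<close>

lemma B_prod_exact:
  assumes "p \<in> dyck n" "bounce_comp n p = ps @ \<sigma>" "length ks = length ps"
    and "sorted_wrt (\<ge>) ps" "\<forall>a\<in>set ps. \<forall>u\<in>set \<sigma>. u \<le> a"
    and "sq_sum (bounce_comp n p) = 2 * area n p + n"
    and "B_prod n (zip (rev [1..<Suc (length ps)]) ks) (Some p) = Some q"
    and "sq_sum (bounce_comp n q) = sq_sum (bounce_comp n p)"
  shows "mset (bounce_comp n q) = mset (bounce_comp n p) \<and>
    comp_bounce (bounce_comp n q) = comp_bounce (bounce_comp n p) + sum_list ks \<and>
    (\<forall>w. drops w (bounce_comp n q) =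
       drops w \<sigma> + mset (map snd (filter (\<lambda>(v, k). v = w) (zip (rev ps) ks))))"
  using assms
proof (induction ps arbitrary: p \<sigma> ks rule: rev_induct)
  case (snoc v ps)
  obtain k ks' where ks: "ks = k # ks'" "length ks' = length ps"
    using snoc.prems(3) by (cases ks) auto
  have "rev [1..<Suc (length (ps @ [v]))] = Suc (length ps) # rev [1..<Suc (length ps)]" by simp
  then have "B_prod n (zip (rev [1..<Suc (length ps)]) ks') (B_op n (Suc (length ps)) k (Some p)) = Some q"
    using snoc.prems(7) ks by (simp del: upt_Suc)
  then obtain r where r: "B_op n (Suc (length ps)) k (Some p) = Some r"
    and q: "B_prod n (zip (rev [1..<Suc (length ps)]) ks') (Some r) = Some q"
    by (cases "B_op n (Suc (length ps)) k (Some p)") (auto simp: B_prod_None simp del: upt_Suc)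
  note r' = B_op_sq_sum_le[OF snoc.prems(1) r]
  \<comment> \<open>The remaining factors cannot raise the squares again, so equality at the end
    forces equality after the first factor.\<close>
  have sq: "sq_sum (bounce_comp n r) = sq_sum (bounce_comp n p)"
    using B_prod_sq_sum_le[OF _ q] r' snoc.prems(8) by simp
  obtain s1 s2 where s: "\<sigma> = s1 @ s2" "bounce_comp n r = ps @ s1 @ v # s2" "(\<Sum>u\<leftarrow>s1. v - u) = k"
    using B_op_exact[OF snoc.prems(1) r _ _ snoc.prems(6) sq] snoc.prems(2,5) by auto
  have p: "bounce_comp n p = ps @ v # s1 @ s2" using snoc.prems(2) s by simp
  have le: "\<forall>u\<in>set (s1 @ s2). u \<le> v" using snoc.prems(5) s by simp
  have IH: "mset (bounce_comp n q) = mset (bounce_comp n r) \<and>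
    comp_bounce (bounce_comp n q) = comp_bounce (bounce_comp n r) + sum_list ks' \<and>
    (\<forall>w. drops w (bounce_comp n q) =
       drops w (s1 @ v # s2) + mset (map snd (filter (\<lambda>(v, k). v = w) (zip (rev ps) ks'))))"
    using snoc.prems s ks r' sq q by (intro snoc.IH) (auto simp: sorted_wrt_append simp del: upt_Suc)
  show ?case
    using IH s p ks comp_bounce_move[of s1 v ps s2] le drops_insert[OF le] by auto
qed simp


section \<open>Partitions\<close>

text \<open>The multiplicity form of a partition, numbered from 1 to match
  \<open>dpart\<close>.\<close>

definition blocks :: "nat \<Rightarrow> (nat \<Rightarrow> nat) \<Rightarrow> (nat \<Rightarrow> nat) \<Rightarrow> nat list" where
  "blocks l m d = concat (map (\<lambda>k. replicate (m k) (d k)) [1..<Suc l])"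

lemma blocks_0 [simp]: "blocks 0 m d = []"
  by (simp add: blocks_def)

lemma blocks_Suc: "blocks (Suc l) m d = blocks l m d @ replicate (m (Suc l)) (d (Suc l))"
  by (simp add: blocks_def)

lemma length_blocks: "length (blocks l m d) = (\<Sum>k = 1..l. m k)"
  by (induction l) (simp_all add: blocks_Suc)

lemma sum_list_blocks: "sum_list (blocks l m d) = (\<Sum>k = 1..l. m k * d k)"
  by (induction l) (simp_all add: blocks_Suc sum_list_replicate)

lemma length_filter_blocks:
  "length (filter P (blocks l m d)) = (\<Sum>k = 1..l. if P (d k) then m k else 0)"
  by (induction l) (simp_all add: blocks_Suc)

lemma count_list_conv_length_filter: "count_list xs x = length (filter (\<lambda>y. y = x) xs)"
  by (induction xs) auto

lemma count_list_blocks: "count_list (blocks l m d) x = (\<Sum>k = 1..l. if d k = x then m k else 0)"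
  by (simp add: count_list_conv_length_filter length_filter_blocks)

lemma set_blocks_subset: "set (blocks l m d) \<subseteq> d ` {1..l}"
  by (induction l) (auto simp: blocks_Suc)

lemma sorted_blocks:
  assumes "\<And>j k. 1 \<le> j \<Longrightarrow> j < k \<Longrightarrow> k \<le> l \<Longrightarrow> d k < d j"
  shows "sorted_wrt (\<ge>) (blocks l m d)"
  using assms
proof (induction l)
  case (Suc l)
  have "d (Suc l) \<le> x" if "x \<in> set (blocks l m d)" for x
    using that Suc.prems[of _ "Suc l"] set_blocks_subset[of l m d] by fastforce
  moreover have "sorted_wrt (\<ge>) (replicate a b)" for a and b :: nat
    by (induction a) auto
  ultimately show ?case using Suc by (auto simp: blocks_Suc sorted_wrt_append)
qed simp

lemma sorted_wrt_ge_unique: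
  assumes "sorted_wrt (\<ge>) xs" "sorted_wrt (\<ge>) ys" "mset xs = mset ys"
  shows "xs = (ys :: nat list)"
proof -
  have "sort xs = rev xs" "sort xs = rev ys"
    using assms by (auto intro!: properties_for_sort simp: sorted_wrt_rev)
  then show ?thesis by simp
qed

lemma rev_sorted_list_of_set_less: "sorted_wrt (>) (rev (sorted_list_of_set (A :: nat set)))"
  by (simp add: sorted_wrt_rev)

lemma dpart_less:
  assumes "1 \<le> j" "j < k" "k \<le> num_dparts la"
  shows "dpart la k < dpart la j"
proof -
  have "j - 1 < k - 1" "k - 1 < length (rev (sorted_list_of_set (set la)))"
    using assms by (auto simp: num_dparts_def)
  from sorted_wrt_nth_less[OF rev_sorted_list_of_set_less this] show ?thesis by (simp add: dpart_def)
qed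

lemma bij_betw_dpart: "bij_betw (dpart la) {1..num_dparts la} (set la)"
proof -
  let ?ys = "rev (sorted_list_of_set (set la))"
  have "bij_betw (\<lambda>i. ?ys ! i) {..<length ?ys} (set ?ys)"
    by (intro bij_betw_nth) auto
  moreover have "bij_betw (\<lambda>k. k - 1) {1..num_dparts la} {..<length ?ys}"
    by (rule bij_betw_byWitness[of _ Suc]) (auto simp: num_dparts_def)
  ultimately have "bij_betw ((\<lambda>i. ?ys ! i) \<circ> (\<lambda>k. k - 1)) {1..num_dparts la} (set ?ys)"
    by (rule bij_betw_trans[rotated])
  then show ?thesis by (simp add: o_def dpart_def[abs_def])
qed

lemma dpart_in_set: "k \<in> {1..num_dparts la} \<Longrightarrow> dpart la k \<in> set la"
  using bij_betwE[OF bij_betw_dpart] by blast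

lemma partition_eq_blocks:
  assumes "sorted_wrt (\<ge>) la"
  shows "la = blocks (num_dparts la) (\<lambda>k. count_list la (dpart la k)) (dpart la)"
proof (rule sorted_wrt_ge_unique[OF assms sorted_blocks[OF dpart_less]])
  let ?be = "blocks (num_dparts la) (\<lambda>k. count_list la (dpart la k)) (dpart la)"
  have "count_list ?be x = count_list la x" for x
  proof -
    have "count_list ?be x = (\<Sum>k = 1..num_dparts la. (\<lambda>y. if y = x then count_list la y else 0) (dpart la k))"
      by (simp add: count_list_blocks)
    also have "\<dots> = (\<Sum>y\<in>set la. if y = x then count_list la y else 0)"
      by (rule sum.reindex_bij_betw[OF bij_betw_dpart])
    also have "\<dots> = count_list la x" by (simp add: count_list_0_iff)
    finally show ?thesis .
  qed
  then show "mset la = mset ?be" by (intro multiset_eqI) (simp add: count_mset)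
qed auto

context
  fixes l :: nat and m d :: "nat \<Rightarrow> nat"
  assumes dec: "\<And>j k. 1 \<le> j \<Longrightarrow> j < k \<Longrightarrow> k \<le> l \<Longrightarrow> d k < d j"
    and mpos: "\<And>k. k \<in> {1..l} \<Longrightarrow> 0 < m k"
begin

lemma inj_on_blocks: "inj_on d {1..l}"
proof (rule inj_onI)
  fix x y assume "x \<in> {1..l}" "y \<in> {1..l}" "d x = d y"
  then show "x = y" using dec[of x y] dec[of y x] by (cases x y rule: linorder_cases) auto
qed

lemma set_blocks: "set (blocks l m d) = d ` {1..l}"
  using mpos by (auto simp: blocks_def atLeastLessThanSuc_atLeastAtMost simp del: upt_Suc)

lemma num_dparts_blocks: "num_dparts (blocks l m d) = l"
  using card_image[OF inj_on_blocks] by (simp add: num_dparts_def set_blocks)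

lemma dpart_blocks:
  assumes "k \<in> {1..l}"
  shows "dpart (blocks l m d) k = d k"
proof -
  let ?xs = "rev (map d [1..<Suc l])"
  have "sorted_wrt (<) ?xs"
    unfolding sorted_wrt_rev sorted_wrt_map
    by (auto simp: sorted_wrt_iff_nth_less dec simp del: upt_Suc)
  then have "sorted_list_of_set (set ?xs) = ?xs"
    by (intro sorted_list_of_set.idem_if_sorted_distinct) (auto simp: strict_sorted_iff simp del: upt_Suc)
  moreover have "set ?xs = set (blocks l m d)" by (auto simp: set_blocks simp del: upt_Suc)
  ultimately have "sorted_list_of_set (set (blocks l m d)) = ?xs" by simp
  then show ?thesis using assms by (cases k) (auto simp: dpart_def simp del: upt_Suc)
qed

lemma count_list_blocks_part:
  assumes "k \<in> {1..l}"
  shows "count_list (blocks l m d) (d k) = m k"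
proof -
  have "(\<Sum>j = 1..l. if d j = d k then m j else 0) = (\<Sum>j = 1..l. if j = k then m j else 0)"
  proof (intro sum.cong refl)
    fix j assume "j \<in> {1..l}"
    then show "(if d j = d k then m j else 0) = (if j = k then m j else 0)"
      using inj_on_eq_iff[OF inj_on_blocks _ assms, of j] by simp
  qed
  then show ?thesis using assms by (simp add: count_list_blocks)
qed

end


section \<open>Conjugate partitions\<close>

lemma piecewise_constant_eq_blocks:
  assumes "e 0 = 0" "\<And>k. k < l \<Longrightarrow> e k \<le> e (Suc k)"
    and "\<And>k j. k < l \<Longrightarrow> e k < j \<Longrightarrow> j \<le> e (Suc k) \<Longrightarrow> g j = c (Suc k)"
  shows "map g [1..<Suc (e l)] = blocks l (\<lambda>k. e k - e (k - 1)) c"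
  using assms
proof (induction l)
  case (Suc l)
  have le: "e l \<le> e (Suc l)" using Suc.prems by simp
  have "[1..<Suc (e (Suc l))] = [1..<Suc (e l)] @ [Suc (e l)..<Suc (e (Suc l))]"
    using upt_add_eq_append[of 1 "Suc (e l)" "e (Suc l) - e l"] le by (simp del: upt_Suc)
  moreover have "map g [Suc (e l)..<Suc (e (Suc l))] = replicate (e (Suc l) - e l) (c (Suc l))"
    using Suc.prems(3)[of l] by (intro nth_equalityI) (auto simp del: upt_Suc)
  ultimately show ?case using Suc by (simp add: blocks_Suc del: upt_Suc)
qed simp

text \<open>The number of parts that are at least \<open>j\<close> changes only when
  \<open>j\<close> crosses a distinct part. \<open>e\<close> lists the distinct parts in increasing
  order after a leading 0, so its gaps are the multiplicities of the conjugate.\<close>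

lemma conjugate_eq_blocks:
  assumes dec: "\<And>j k. 1 \<le> j \<Longrightarrow> j < k \<Longrightarrow> k \<le> l \<Longrightarrow> d k < d j"
    and mpos: "\<And>k. k \<in> {1..l} \<Longrightarrow> 0 < m k"
  defines "e \<equiv> \<lambda>k. if k = 0 then 0 else d (l + 1 - k)"
  shows "conjugate (blocks l m d) = blocks l (\<lambda>k. e k - e (k - 1)) (\<lambda>k. \<Sum>j = 1..l + 1 - k. m j)"
proof -
  define g where "g j = length (filter (\<lambda>a. j \<le> a) (blocks l m d))" for j
  have "Max (insert 0 (set (blocks l m d))) = e l"
  proof (rule Max_eqI)
    fix y assume "y \<in> insert 0 (set (blocks l m d))"
    then consider "y = 0" | t where "t \<in> {1..l}" "y = d t"
      using set_blocks_subset[of l m d] by blast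
    then show "y \<le> e l"
    proof cases
      case 2
      then show ?thesis using dec[of 1 t] by (cases "t = 1") (auto simp: e_def)
    qed simp
  next
    show "e l \<in> insert 0 (set (blocks l m d))"
    proof (cases "l = 0")
      case False
      have "set (blocks l m d) = d ` {1..l}" by (rule set_blocks) (use dec mpos in auto)
      then show ?thesis using False by (auto simp: e_def)
    qed (simp add: e_def)
  qed simp
  then have "conjugate (blocks l m d) = map g [1..<Suc (e l)]"
    by (simp add: conjugate_def g_def del: upt_Suc)
  also have "\<dots> = blocks l (\<lambda>k. e k - e (k - 1)) (\<lambda>k. \<Sum>j = 1..l + 1 - k. m j)"
  proof (rule piecewise_constant_eq_blocks)
    fix k assume k: "k < l"
    show "e k \<le> e (Suc k)"
    proof (cases "k = 0")
      case False
      then have "d (l + 1 - k) < d (l - k)" using k by (intro dec) auto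
      then show ?thesis using False by (simp add: e_def)
    qed (simp add: e_def)
    fix j assume j: "e k < j" "j \<le> e (Suc k)"
    have *: "j \<le> d t \<longleftrightarrow> t \<le> l - k" if t: "t \<in> {1..l}" for t
    proof (cases "t \<le> l - k")
      case True
      then have "d (l - k) \<le> d t" using dec[of t "l - k"] t by (cases "t = l - k") auto
      then show ?thesis using True j k by (simp add: e_def)
    next
      case False
      then have "k \<noteq> 0" "l + 1 - k \<le> t" using t by auto
      then have "d t < d (l + 1 - k)" if "t \<noteq> l + 1 - k"
        using t k that by (intro dec) auto
      then have "d t \<le> d (l + 1 - k)" by fastforce
      then show ?thesis using False j \<open>k \<noteq> 0\<close> by (simp add: e_def)
    qed
    have "g j = (\<Sum>t = 1..l. if j \<le> d t then m t else 0)" by (simp add: g_def length_filter_blocks)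
    also have "\<dots> = (\<Sum>t = 1..l. if t \<le> l - k then m t else 0)" by (intro sum.cong refl) (simp add: *)
    also have "\<dots> = (\<Sum>t = 1..l - k. m t)" by (rule sum.mono_neutral_cong_right) auto
    finally show "g j = (\<Sum>t = 1..l + 1 - Suc k. m t)" by simp
  qed (simp add: e_def)
  finally show ?thesis .
qed

text \<open>In a weakly decreasing list the parts that are at least \<open>j\<close> form an initial
  segment.\<close>

lemma less_length_filter_iff:
  fixes la :: "nat list"
  assumes "sorted_wrt (\<ge>) la" "i < length la"
  shows "i < length (filter (\<lambda>a. j \<le> a) la) \<longleftrightarrow> j \<le> la ! i"
  using assms
proof (induction la arbitrary: i)
  case (Cons a la)
  show ?case
  proof (cases "j \<le> a")
    case True
    then show ?thesis using Cons by (cases i) auto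
  next
    case False
    then have "\<not> j \<le> x" if "x \<in> set la" for x
      using Cons.prems(1) that le_trans[of j x a] by auto
    then have "filter (\<lambda>a. j \<le> a) la = []" by (auto simp: filter_empty_conv)
    moreover have "(a # la) ! i \<le> a" using Cons.prems by (cases i) auto
    ultimately show ?thesis using False by simp
  qed
qed simp

lemma conjugate_conjugate:
  assumes "la \<in> partitions n"
  shows "conjugate (conjugate la) = la"
proof -
  have srt: "sorted_wrt (\<ge>) la" and pos: "\<forall>a\<in>set la. 0 < a" using assms by (auto simp: partitions_def)
  define N where "N = Max (insert 0 (set la))"
  define g where "g j = length (filter (\<lambda>a. j \<le> a) la)" for j
  have c: "conjugate la = map g [1..<Suc N]" by (simp add: conjugate_def N_def g_def[abs_def] del: upt_Suc)
  have N: "a \<le> N" if "a \<in> set la" for a using that by (simp add: N_def)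
  have "Max (insert 0 (set (conjugate la))) = length la"
  proof (rule Max_eqI)
    show "length la \<in> insert 0 (set (conjugate la))"
    proof (cases la)
      case (Cons a al)
      then have "1 \<le> N" using N[of a] pos by auto
      moreover have "g 1 = length la" using pos by (auto simp: g_def Suc_le_eq)
      ultimately show ?thesis by (force simp: c simp del: upt_Suc)
    qed simp
  qed (auto simp: c g_def simp del: upt_Suc)
  then have cc: "conjugate (conjugate la) =
      map (\<lambda>i. length (filter (\<lambda>a. i \<le> a) (conjugate la))) [1..<Suc (length la)]"
    unfolding conjugate_def[of "conjugate la"] by simp
  show ?thesis
  proof (rule nth_equalityI)
    fix i assume "i < length (conjugate (conjugate la))"
    then have i: "i < length la" by (simp add: cc del: upt_Suc)
    have "conjugate (conjugate la) ! i = length (filter (\<lambda>a. Suc i \<le> a) (conjugate la))"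
      using i by (simp add: cc del: upt_Suc)
    also have "\<dots> = length (filter (\<lambda>j. Suc i \<le> g j) [1..<Suc N])"
      by (simp add: c filter_map o_def del: upt_Suc)
    also have "\<dots> = card (set (filter (\<lambda>j. Suc i \<le> g j) [1..<Suc N]))"
      by (rule distinct_card[symmetric]) (simp del: upt_Suc)
    also have "set (filter (\<lambda>j. Suc i \<le> g j) [1..<Suc N]) = {1..la ! i}"
    proof -
      have "Suc i \<le> g j \<longleftrightarrow> j \<le> la ! i" for j
        using less_length_filter_iff[OF srt i, of j] by (simp add: g_def Suc_le_eq)
      then have "set (filter (\<lambda>j. Suc i \<le> g j) [1..<Suc N]) = {j \<in> {1..N}. j \<le> la ! i}"
        by (simp only: set_filter set_upt atLeastLessThanSuc_atLeastAtMost)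
      also have "\<dots> = {1..la ! i}" using N[OF nth_mem[OF i]] by auto
      finally show ?thesis .
    qed
    finally show "conjugate (conjugate la) ! i = la ! i" by simp
  qed (simp add: cc del: upt_Suc)
qed

text \<open>The cells of the Young diagram, counted by columns.\<close>

lemma sum_length_filter_ge:
  assumes "\<forall>a\<in>set la. a \<le> N"
  shows "(\<Sum>j = 1..N. length (filter (\<lambda>a. j \<le> a) la)) = sum_list la"
  using assms
proof (induction la)
  case (Cons a la)
  have "(\<Sum>j = 1..N. length (filter (\<lambda>b. j \<le> b) (a # la))) =
      (\<Sum>j = 1..N. (if j \<le> a then 1 else 0) + length (filter (\<lambda>b. j \<le> b) la))"
    by (intro sum.cong) auto
  also have "\<dots> = (\<Sum>j = 1..N. if j \<le> a then 1 else 0) + sum_list la"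
    using Cons by (simp add: sum.distrib)
  also have "(\<Sum>j = 1..N. if j \<le> a then 1 else 0) = (\<Sum>j = 1..a. 1)"
    using Cons.prems by (intro sum.mono_neutral_cong_right) auto
  finally show ?case by simp
qed simp

lemma sum_list_map_upt_eq_sum: "sum_list (map g [1..<Suc N]) = (\<Sum>j = 1..N. g j :: nat)"
  by (induction N) simp_all

lemma conjugate_partitions:
  assumes "la \<in> partitions n"
  shows "conjugate la \<in> partitions n"
proof -
  define N where "N = Max (insert 0 (set la))"
  have N: "\<forall>a\<in>set la. a \<le> N" by (simp add: N_def)
  have c: "conjugate la = map (\<lambda>j. length (filter (\<lambda>a. j \<le> a) la)) [1..<Suc N]"
    by (simp add: conjugate_def N_def)
  have "length (filter (\<lambda>a. k \<le> a) la) \<le> length (filter (\<lambda>a. j \<le> a) la)" if "j \<le> k" for j k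
    using that by (induction la) auto
  then have "sorted_wrt (\<ge>) (conjugate la)"
    unfolding c by (auto simp: sorted_wrt_map sorted_wrt_iff_nth_less simp del: upt_Suc)
  moreover have "0 < length (filter (\<lambda>a. j \<le> a) la)" if "1 \<le> j" "j \<le> N" for j
  proof -
    have "N \<in> insert 0 (set la)" unfolding N_def by (intro Max_in) auto
    then have "N \<in> set (filter (\<lambda>a. j \<le> a) la)" using that by auto
    then show ?thesis by (rule length_pos_if_in_set)
  qed
  then have "\<forall>a\<in>set (conjugate la). 0 < a" unfolding c by (auto simp del: upt_Suc length_greater_0_conv)
  moreover have "sum_list (conjugate la) = n"
    unfolding c sum_list_map_upt_eq_sum using sum_length_filter_ge[OF N] assms by (simp add: partitions_def)
  ultimately show ?thesis by (simp add: partitions_def)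
qed

text \<open>The classical identity between the sum of (k - 1) times part k and the sum of the
  binomials "column length choose 2". A new largest part \<open>a\<close> lengthens columns 1 to
  \<open>a\<close> by one cell each, which adds \<open>2 * ?g j + 1\<close> to the square of column
  \<open>j\<close>.\<close>

lemma two_comp_bounce_eq_sq_sum_conjugate:
  assumes "sorted_wrt (\<ge>) la"
  shows "2 * comp_bounce la + sum_list la = sq_sum (conjugate la)"
proof -
  have *: "2 * comp_bounce la + sum_list la =
      (\<Sum>j = 1..N. length (filter (\<lambda>a. j \<le> a) la) * length (filter (\<lambda>a. j \<le> a) la))"
    if "\<forall>a\<in>set la. a \<le> N" for N
    using that assms
  proof (induction la)
    case (Cons a la)
    let ?g = "\<lambda>j. length (filter (\<lambda>b. j \<le> b) la)"
    have "(\<Sum>j = 1..N. length (filter (\<lambda>b. j \<le> b) (a # la)) * length (filter (\<lambda>b. j \<le> b) (a # la))) =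
        (\<Sum>j = 1..N. ?g j * ?g j + (if j \<le> a then 2 * ?g j + 1 else 0))"
      by (intro sum.cong) auto
    also have "\<dots> = 2 * comp_bounce la + sum_list la + (\<Sum>j = 1..N. if j \<le> a then 2 * ?g j + 1 else 0)"
      using Cons by (simp add: sum.distrib)
    also have "(\<Sum>j = 1..N. if j \<le> a then 2 * ?g j + 1 else 0) = (\<Sum>j = 1..a. 2 * ?g j + 1)"
      using Cons.prems by (intro sum.mono_neutral_cong_right) auto
    also have "\<dots> = 2 * sum_list la + a"
      using sum_length_filter_ge[of la a] Cons.prems by (simp add: sum_Suc flip: sum_distrib_left)
    finally show ?case by simp
  qed simp
  show ?thesis
    unfolding sq_sum_def conjugate_def map_map o_def sum_list_map_upt_eq_sum by (rule *) auto
qed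


section \<open>Count maps\<close>

lemma I_bnc_list_eq:
  "I_bnc_list la = concat (map (\<lambda>i. map (Pair i)
     [1..<Suc (count_list la (dpart la (num_dparts la - i)))]) [1..<num_dparts la])"
  by (simp add: I_bnc_list_def)

text \<open>Strictness yields distinct indices, and comparing second components shows that (i, r -
  1) is applied before (i, r).\<close>

definition lex_less :: "nat \<times> nat \<Rightarrow> nat \<times> nat \<Rightarrow> bool" where
  "lex_less x y \<longleftrightarrow> fst x < fst y \<or> fst x = fst y \<and> snd x < snd y"

lemma sorted_I_bnc_list: "sorted_wrt lex_less (I_bnc_list la)"
proof -
  have "sorted_wrt lex_less (concat (map (\<lambda>i. map (Pair i) [1..<Suc (h i)]) [1..<l]))" for h l
  proof (induction l)
    case (Suc l)
    have "sorted_wrt lex_less (map (Pair l) [1..<Suc (h l)])"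
      by (auto simp: sorted_wrt_map lex_less_def simp del: upt_Suc)
    moreover have "[1..<Suc l] = (if l = 0 then [] else [1..<l] @ [l])" by simp
    ultimately show ?case using Suc
      by (auto simp: sorted_wrt_append lex_less_def[of "(_, _)"] simp del: upt_Suc)
  qed simp
  then show ?thesis unfolding I_bnc_list_eq .
qed

lemma distinct_I_bnc_list: "distinct (I_bnc_list la)"
proof -
  have "sorted_wrt lex_less zs \<Longrightarrow> distinct zs" for zs
    by (induction zs) (auto simp: lex_less_def)
  then show ?thesis using sorted_I_bnc_list by blast
qed

lemma rev_upt_1: "rev [1..<l] = map (\<lambda>i. l - i) [1..<l]"
  by (rule nth_equalityI) (auto simp: rev_nth)

text \<open>Index \<open>i\<close> belongs to the distinct part number \<open>l - i\<close>, so the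
  product reads the partition from right to left, without the copies of its smallest part.\<close>

lemma map_dpart_I_bnc_list:
  fixes la
  defines "l \<equiv> num_dparts la" and "m \<equiv> \<lambda>k. count_list la (dpart la k)"
  shows "map (\<lambda>(i, r). dpart la (l - i)) (I_bnc_list la) = rev (blocks (l - 1) m (dpart la))"
proof (cases "l = 0")
  case False
  have "rev (blocks (l - 1) m (dpart la)) = concat (map (\<lambda>k. replicate (m k) (dpart la k)) (rev [1..<l]))"
    using False by (simp add: blocks_def rev_concat rev_map o_def del: upt_Suc)
  also have "\<dots> = map (\<lambda>(i, r). dpart la (l - i)) (I_bnc_list la)"
    unfolding rev_upt_1 I_bnc_list_eq
    by (simp add: map_concat o_def l_def m_def map_replicate_const del: upt_Suc)
  finally show ?thesis by simp
qed (simp add: I_bnc_list_eq l_def)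

lemma map_diff_upt: "map (\<lambda>r. 1 + (a + b) - r) [1..<Suc b] = rev [Suc a..<Suc (a + b)]"
  by (rule nth_equalityI) (auto simp: rev_nth simp del: upt_Suc)

text \<open>The positions acted upon decrease by one from factor to factor, so each is used once and
  only positions to its right have been disturbed before. This is the shape required by
  \<open>B_prod_exact\<close>.\<close>

lemma map_bnc_idx_I_bnc_list:
  fixes la
  defines "l \<equiv> num_dparts la" and "m \<equiv> \<lambda>k. count_list la (dpart la k)"
  shows "map (\<lambda>(i, r). bnc_idx la i r) (I_bnc_list la) = rev [1..<Suc (\<Sum>j = 1..l - 1. m j)]"
proof -
  define M where "M k = (\<Sum>j = 1..k. m j)" for k
  have "concat (map (\<lambda>i. map (\<lambda>r. 1 + M (l - i) - r) [1..<Suc (m (l - i))]) [1..<Suc t]) =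
      rev [Suc (M (l - 1 - t))..<Suc (M (l - 1))]" if "t \<le> l - 1" for t
    using that
  proof (induction t)
    case (Suc t)
    define k where "k = l - 1 - Suc t"
    have k: "l - Suc t = Suc k" "l - 1 - t = Suc k" using Suc.prems by (auto simp: k_def)
    have MS: "M (Suc k) = M k + m (Suc k)" by (simp add: M_def)
    have le: "M (Suc k) \<le> M (l - 1)" unfolding M_def using k by (intro sum_mono2) auto
    have "[1..<Suc (Suc t)] = [1..<Suc t] @ [Suc t]" by (rule upt_Suc_append) simp
    then have "concat (map (\<lambda>i. map (\<lambda>r. 1 + M (l - i) - r) [1..<Suc (m (l - i))]) [1..<Suc (Suc t)]) =
        rev [Suc (M (Suc k))..<Suc (M (l - 1))] @ rev [Suc (M k)..<Suc (M (Suc k))]"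
      using Suc k MS map_diff_upt[of "M k" "m (Suc k)"] by (simp del: upt_Suc)
    also have "\<dots> = rev ([Suc (M k)..<Suc (M (Suc k))] @ [Suc (M (Suc k))..<Suc (M (l - 1))])"
      by (simp del: upt_Suc)
    also have "[Suc (M k)..<Suc (M (Suc k))] @ [Suc (M (Suc k))..<Suc (M (l - 1))] =
        [Suc (M k)..<Suc (M (l - 1))]"
      using upt_add_eq_append[of "Suc (M k)" "Suc (M (Suc k))" "M (l - 1) - M (Suc k)"] le MS
      by (simp del: upt_Suc)
    finally show ?case unfolding k_def .
  qed simp
  from this[of "l - 1"] show ?thesis
    unfolding I_bnc_list_eq
    by (cases "l = 0") (simp_all add: map_concat o_def bnc_idx_def M_def m_def l_def del: upt_Suc)
qed

lemma filter_I_bnc_list: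
  assumes "i \<in> {1..<num_dparts la}"
  shows "mset (map f (filter (\<lambda>z. fst z = i) (I_bnc_list la))) =
    mset (map (\<lambda>r. f (i, r)) [1..<Suc (count_list la (dpart la (num_dparts la - i)))])"
proof -
  let ?m = "count_list la (dpart la (num_dparts la - i))"
  have "mset (filter (\<lambda>z. fst z = i) (I_bnc_list la)) = mset (map (Pair i) [1..<Suc ?m])"
  proof (subst set_eq_iff_mset_eq_distinct[symmetric])
    show "set (filter (\<lambda>z. fst z = i) (I_bnc_list la)) = set (map (Pair i) [1..<Suc ?m])"
      unfolding set_filter set_I_bnc_list using assms by (auto simp: I_bnc_def simp del: upt_Suc)
  qed (auto simp: distinct_I_bnc_list distinct_map inj_on_def simp del: upt_Suc)
  then have "image_mset f (mset (filter (\<lambda>z. fst z = i) (I_bnc_list la))) =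
      image_mset f (mset (map (Pair i) [1..<Suc ?m]))" by simp
  then show ?thesis by (simp only: mset_map[symmetric] map_map o_def)
qed

lemma antitone_unique:
  fixes f g :: "nat \<Rightarrow> nat"
  assumes "mset (map f [1..<Suc m]) = mset (map g [1..<Suc m])"
    and f: "\<And>r. 1 \<le> r \<Longrightarrow> r < m \<Longrightarrow> f (r + 1) \<le> f r"
    and g: "\<And>r. 1 \<le> r \<Longrightarrow> r < m \<Longrightarrow> g (r + 1) \<le> g r"
    and r: "r \<in> {1..m}"
  shows "f r = g r"
proof -
  have srt: "sorted_wrt (\<ge>) (map h [1..<Suc m])"
    if h: "\<And>r. 1 \<le> r \<Longrightarrow> r < m \<Longrightarrow> h (r + 1) \<le> h r" for h :: "nat \<Rightarrow> nat"
  proof -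
    have "h b \<le> h a" if "1 \<le> a" "a \<le> b" "b \<le> m" for a b
      using that(2,3)
    proof (induction b rule: dec_induct)
      case (step b)
      then have "h (b + 1) \<le> h b" using that(1) by (intro h) auto
      then show ?case using step by auto
    qed simp
    then show ?thesis by (auto simp: sorted_wrt_iff_nth_less simp del: upt_Suc)
  qed
  have "map f [1..<Suc m] = map g [1..<Suc m]"
    by (rule sorted_wrt_ge_unique[OF srt srt assms(1)]) (use f g in auto)
  then have "\<forall>r\<in>set [1..<Suc m]. f r = g r" by (simp only: map_eq_conv)
  then show ?thesis using r by (simp del: upt_Suc)
qed

lemma partitions_compositions: "la \<in> partitions n \<Longrightarrow> la \<in> compositions n"
  by (simp add: partitions_def compositions_def)

lemma count_list_dpart_pos: "k \<in> {1..num_dparts la} \<Longrightarrow> 0 < count_list la (dpart la k)"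
  using dpart_in_set[of k la] by (simp add: count_list_0_iff neq0_conv[symmetric] del: neq0_conv)

text \<open>The multiplicity in question is the gap between distinct parts \<open>i + 1\<close> and
  \<open>i + 2\<close> of \<open>la\<close>, where a missing part counts as 0. The bound places the
  rows changed by the A operators inside the first part of size
  \<open>dpart la (i + 1)\<close>.\<close>

lemma conjugate_block_structure:
  assumes "la \<in> partitions n"
  shows "num_dparts (conjugate la) = num_dparts la"
    and "i \<in> {1..<num_dparts la} \<Longrightarrow>
      count_list (conjugate la) (dpart (conjugate la) (num_dparts la - i)) \<le> dpart la (i + 1)"
proof -
  define l m d where "l = num_dparts la" and "m = (\<lambda>k. count_list la (dpart la k))" and "d = dpart la"
  have la: "la = blocks l m d"
    using partition_eq_blocks[of la] assms by (simp add: partitions_def l_def m_def d_def)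
  have dec: "d k < d j" if "1 \<le> j" "j < k" "k \<le> l" for j k
    using dpart_less[of j k la] that by (simp add: d_def l_def)
  have mpos: "0 < m k" if "k \<in> {1..l}" for k
    using count_list_dpart_pos[of k la] that by (simp add: m_def l_def)
  have dpos: "0 < d k" if "k \<in> {1..l}" for k
    using dpart_in_set[of k la] that assms by (simp add: d_def l_def partitions_def)
  define e where "e = (\<lambda>k. if k = 0 then 0 else d (l + 1 - k))"
  define m' where "m' = (\<lambda>k. e k - e (k - 1))"
  define d' where "d' = (\<lambda>k. \<Sum>j = 1..l + 1 - k. m j)"
  have c: "conjugate la = blocks l m' d'"
    unfolding la m'_def d'_def e_def by (rule conjugate_eq_blocks) (use dec mpos in auto)
  have dec': "d' k < d' j" if "1 \<le> j" "j < k" "k \<le> l" for j k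
    unfolding d'_def
  proof (rule sum_strict_mono2)
    show "l + 1 - j \<in> {1..l + 1 - j} - {1..l + 1 - k}" using that by auto
    show "0 < m (l + 1 - j)" using that by (intro mpos) auto
  qed (use that in auto)
  have mpos': "0 < m' k" if "k \<in> {1..l}" for k
  proof (cases "k = 1")
    case True
    then show ?thesis using dpos[of l] that by (simp add: m'_def e_def)
  next
    case False
    then have "d (l + 1 - (k - 1)) < d (l + 1 - k)" using that by (intro dec) auto
    then show ?thesis using that False by (simp add: m'_def e_def)
  qed
  show nd: "num_dparts (conjugate la) = num_dparts la"
    unfolding c l_def[symmetric] by (rule num_dparts_blocks) (use dec' mpos' in auto)
  assume "i \<in> {1..<num_dparts la}"
  then have i: "l - i \<in> {1..l}" and il: "i < l" by (auto simp: l_def)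
  have "dpart (conjugate la) (l - i) = d' (l - i)"
    unfolding c by (rule dpart_blocks) (use dec' mpos' i in auto)
  moreover have "count_list (conjugate la) (d' (l - i)) = m' (l - i)"
    unfolding c by (rule count_list_blocks_part) (use dec' mpos' i in auto)
  moreover have "m' (l - i) \<le> d (i + 1)" using il by (simp add: m'_def e_def Suc_diff_le)
  ultimately show "count_list (conjugate la) (dpart (conjugate la) (num_dparts la - i)) \<le> dpart la (i + 1)"
    by (simp add: l_def d_def)
qed

lemma I_bnc_conjugateD:
  assumes la: "la \<in> partitions n" and "(i, r) \<in> I_bnc (conjugate la)"
  shows "i \<in> {1..<num_dparts la}" "r \<in> {1..dpart la (i + 1)}"
proof -
  have *: "1 \<le> i" "i < num_dparts la" "1 \<le> r"
    "r \<le> count_list (conjugate la) (dpart (conjugate la) (num_dparts la - i))"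
    using assms(2) conjugate_block_structure(1)[OF la] by (auto simp: I_bnc_def)
  then show i: "i \<in> {1..<num_dparts la}" by simp
  show "r \<in> {1..dpart la (i + 1)}" using conjugate_block_structure(2)[OF la i] * by simp
qed

lemma F_setD:
  assumes "(f, la) \<in> F_set n"
  shows "la \<in> partitions n" "f \<in> I_bnc (conjugate la) \<rightarrow>\<^sub>E UNIV"
    and "i \<in> {1..<num_dparts la} \<Longrightarrow> f (i, 1) < dpart la i"
    and "i \<in> {1..<num_dparts la} \<Longrightarrow> 1 \<le> r \<Longrightarrow>
      r < count_list (conjugate la) (dpart (conjugate la) (num_dparts la - i)) \<Longrightarrow> f (i, r + 1) \<le> f (i, r)"
    and "B_sub n la f \<in> Some ` comp_paths n"
  using assms by (auto simp: F_set_def)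

lemma F_set_less_dpart:
  assumes "(f, la) \<in> F_set n" and z: "(i, r) \<in> I_bnc (conjugate la)"
  shows "f (i, r) < dpart la i"
proof -
  have la: "la \<in> partitions n" using F_setD[OF assms(1)] by auto
  have i: "i \<in> {1..<num_dparts la}"
    and r: "1 \<le> r" "r \<le> count_list (conjugate la) (dpart (conjugate la) (num_dparts la - i))"
    using z conjugate_block_structure(1)[OF la] by (auto simp: I_bnc_def)
  have "f (i, r) \<le> f (i, 1)"
    using r
  proof (induction r rule: dec_induct)
    case (step r)
    then have "f (i, r + 1) \<le> f (i, r)" by (intro F_setD(4)[OF assms(1) i]) auto
    then show ?case using step by auto
  qed simp
  also have "\<dots> < dpart la i" by (rule F_setD(3)[OF assms(1) i])
  finally show ?thesis .
qed


section \<open>The map \<open>B\<^sub>f\<close>\<close>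

lemma B_sub_eq_B_prod:
  fixes la f
  defines "mu \<equiv> conjugate la"
  shows "B_sub n la f = B_prod n
    (zip (rev [1..<Suc (\<Sum>j = 1..num_dparts mu - 1. count_list mu (dpart mu j))]) (map f (I_bnc_list mu)))
    (Some (comp_path mu))"
proof -
  have "zip (map (\<lambda>(i, r). bnc_idx mu i r) zs) (map f zs) = map (\<lambda>(i, r). (bnc_idx mu i r, f (i, r))) zs" for zs
    by (induction zs) auto
  then show ?thesis
    unfolding map_bnc_idx_I_bnc_list[symmetric] B_sub_def mu_def
    by (simp add: o_def case_prod_unfold)
qed

lemma B_sub_F_set:
  assumes F: "(f, la) \<in> F_set n" and n: "1 \<le> n"
  defines "mu \<equiv> conjugate la"
  defines "l \<equiv> num_dparts mu"
  shows "\<exists>be\<in>compositions n. B_sub n la f = Some (comp_path be) \<and> mset be = mset mu \<and>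
    comp_bounce be = comp_bounce mu + sum_list (map f (I_bnc_list mu)) \<and>
    area n (comp_path be) = area n (comp_path mu) \<and>
    (\<forall>i\<in>{1..<l}. drops (dpart mu (l - i)) be =
      mset (map (\<lambda>r. f (i, r)) [1..<Suc (count_list mu (dpart mu (l - i)))]))"
proof -
  obtain be where be: "be \<in> compositions n" "B_sub n la f = Some (comp_path be)"
    using F_setD(5)[OF F] by (auto simp: comp_paths_def)
  have mu: "mu \<in> partitions n" unfolding mu_def by (rule conjugate_partitions[OF F_setD(1)[OF F]])
  note muc = partitions_compositions[OF mu]
  have srt: "sorted_wrt (\<ge>) mu" using mu by (simp add: partitions_def)
  define m where "m = (\<lambda>k. count_list mu (dpart mu k))"
  have "mu \<noteq> []" using mu n by (auto simp: partitions_def)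
  then have l: "0 < l" by (simp add: l_def num_dparts_def card_gt_0_iff)
  define ps where "ps = blocks (l - 1) m (dpart mu)"
  \<comment> \<open>The index set omits the smallest distinct part, so no factor starts from one of
    these copies.\<close>
  define \<sigma> where "\<sigma> = replicate (m l) (dpart mu l)"
  define ks where "ks = map f (I_bnc_list mu)"
  have eq: "mu = ps @ \<sigma>"
    using partition_eq_blocks[OF srt] blocks_Suc[of "l - 1" m "dpart mu"] l
    by (simp add: ps_def \<sigma>_def l_def m_def)
  let ?q = "comp_path be"
  have B: "B_prod n (zip (rev [1..<Suc (length ps)]) ks) (Some (comp_path mu)) = Some ?q"
    using be(2) B_sub_eq_B_prod[of n la f] by (simp add: ps_def length_blocks ks_def l_def m_def mu_def del: upt_Suc)
  note pd = comp_path_dyck[OF muc] and bp = bounce_comp_comp_path[OF muc]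
    and bq = bounce_comp_comp_path[OF be(1)]
  have area: "area n ?q = area n (comp_path mu)"
    using B_prod_sq_sum_le[OF pd B] by simp
  have sq: "sq_sum be = sq_sum mu"
    using two_area_comp_path[OF be(1)] two_area_comp_path[OF muc] area by simp
  have rps: "map (\<lambda>(i, r). dpart mu (l - i)) (I_bnc_list mu) = rev ps"
    using map_dpart_I_bnc_list[of mu] by (simp add: ps_def l_def m_def)
  have "length ks = length ps" using arg_cong[OF rps, of length] by (simp add: ks_def)
  then have ex: "mset be = mset mu \<and> comp_bounce be = comp_bounce mu + sum_list ks \<and>
      (\<forall>w. drops w be = drops w \<sigma> + mset (map snd (filter (\<lambda>(v, k). v = w) (zip (rev ps) ks))))"
    using B_prod_exact[OF pd, of ps \<sigma> ks ?q] B eq srt sq bp bq two_area_comp_path[OF muc]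
    by (auto simp: sorted_wrt_append simp del: upt_Suc)
  have dr: "drops (dpart mu (l - i)) be = mset (map (\<lambda>r. f (i, r)) [1..<Suc (count_list mu (dpart mu (l - i)))])"
    if i: "i \<in> {1..<l}" for i
  proof -
    \<comment> \<open>Different first indices name different parts, so selecting by the value of the
      part is the same as selecting by the first index.\<close>
    have inj: "dpart mu (l - j) = dpart mu (l - i) \<longleftrightarrow> j = i" if "j \<in> {1..<l}" for j
    proof (cases i j rule: linorder_cases)
      case less
      then have "dpart mu (l - i) < dpart mu (l - j)" using that by (intro dpart_less) (auto simp: l_def)
      then show ?thesis using less by simp
    next
      case greater
      then have "dpart mu (l - j) < dpart mu (l - i)" using i by (intro dpart_less) (auto simp: l_def)
      then show ?thesis using greater by simp
    qed simp
    have z: "zip (map (\<lambda>(i, r). dpart mu (l - i)) zs) (map f zs) = map (\<lambda>z. (dpart mu (l - fst z), f z)) zs" for zs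
      by (induction zs) auto
    have "dpart mu l < dpart mu (l - i)" using i by (intro dpart_less) (auto simp: l_def)
    then have "dpart mu (l - i) \<notin> set \<sigma>" by (simp add: \<sigma>_def)
    then have drops_\<sigma>: "drops (dpart mu (l - i)) \<sigma> = {#}" by (rule drops_from_notin)
    have fl: "map snd (filter (\<lambda>(v, k). v = dpart mu (l - i)) (zip (rev ps) ks)) =
        map f (filter (\<lambda>z. fst z = i) (I_bnc_list mu))"
    proof -
      have "filter (\<lambda>z. dpart mu (l - fst z) = dpart mu (l - i)) (I_bnc_list mu) =
          filter (\<lambda>z. fst z = i) (I_bnc_list mu)"
      proof (rule filter_cong[OF refl])
        fix z assume "z \<in> set (I_bnc_list mu)"
        then have "fst z \<in> {1..<l}" unfolding set_I_bnc_list by (auto simp: I_bnc_def l_def)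
        then show "dpart mu (l - fst z) = dpart mu (l - i) \<longleftrightarrow> fst z = i" by (rule inj)
      qed
      then show ?thesis unfolding rps[symmetric] ks_def z by (simp add: filter_map o_def)
    qed
    from ex have "drops (dpart mu (l - i)) be = drops (dpart mu (l - i)) \<sigma> +
        mset (map snd (filter (\<lambda>(v, k). v = dpart mu (l - i)) (zip (rev ps) ks)))" by blast
    also have "\<dots> = mset (map f (filter (\<lambda>z. fst z = i) (I_bnc_list mu)))"
      unfolding fl drops_\<sigma> by simp
    also have "\<dots> = mset (map (\<lambda>r. f (i, r)) [1..<Suc (count_list mu (dpart mu (l - i)))])"
      unfolding l_def using i by (intro filter_I_bnc_list) (simp add: l_def)
    finally show ?thesis .
  qed
  show ?thesis using be ex area dr by (auto simp: ks_def simp del: upt_Suc)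
qed

text \<open>The multiset of parts gives the conjugate, hence \<open>la\<close>; the drops then give
  each row of the count map up to order, and monotonicity settles the order.\<close>

lemma inj_on_B_sub:
  assumes n: "1 \<le> n"
  shows "inj_on (\<lambda>(f, la). B_sub n la f) (F_set n)"
proof (rule inj_onI, clarify)
  fix f la g nu assume F: "(f, la) \<in> F_set n" and G: "(g, nu) \<in> F_set n" and eq: "B_sub n la f = B_sub n nu g"
  obtain be where be: "be \<in> compositions n" "B_sub n la f = Some (comp_path be)"
    "mset be = mset (conjugate la)"
    "\<And>i. i \<in> {1..<num_dparts (conjugate la)} \<Longrightarrow>
      drops (dpart (conjugate la) (num_dparts (conjugate la) - i)) be =
      mset (map (\<lambda>r. f (i, r)) [1..<Suc (count_list (conjugate la) (dpart (conjugate la) (num_dparts (conjugate la) - i)))])"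
    using B_sub_F_set[OF F n] by blast
  obtain ga where ga: "ga \<in> compositions n" "B_sub n nu g = Some (comp_path ga)"
    "mset ga = mset (conjugate nu)"
    "\<And>i. i \<in> {1..<num_dparts (conjugate nu)} \<Longrightarrow>
      drops (dpart (conjugate nu) (num_dparts (conjugate nu) - i)) ga =
      mset (map (\<lambda>r. g (i, r)) [1..<Suc (count_list (conjugate nu) (dpart (conjugate nu) (num_dparts (conjugate nu) - i)))])"
    using B_sub_F_set[OF G n] by blast
  note la = F_setD(1)[OF F] and nu = F_setD(1)[OF G]
  have "comp_path be = comp_path ga" using eq be(2) ga(2) by (simp only: option.inject)
  then have bg: "be = ga"
    using bounce_comp_comp_path[OF be(1)] bounce_comp_comp_path[OF ga(1)] by metis
  have "mset (conjugate la) = mset (conjugate nu)" using be(3) ga(3) bg by metis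
  moreover have "sorted_wrt (\<ge>) (conjugate la)" "sorted_wrt (\<ge>) (conjugate nu)"
    using conjugate_partitions[OF la] conjugate_partitions[OF nu] by (simp_all add: partitions_def)
  ultimately have "conjugate la = conjugate nu" by (intro sorted_wrt_ge_unique)
  then have ln: "la = nu" using conjugate_conjugate[OF la] conjugate_conjugate[OF nu] by metis
  have "f z = g z" if z: "z \<in> I_bnc (conjugate la)" for z
  proof -
    obtain i r where zi: "z = (i, r)" by force
    note nd = conjugate_block_structure(1)[OF la]
    define m where "m = count_list (conjugate la) (dpart (conjugate la) (num_dparts la - i))"
    have i: "i \<in> {1..<num_dparts la}" and r: "r \<in> {1..m}"
      using z nd by (auto simp: I_bnc_def zi m_def)
    have "f (i, r) = g (i, r)"
    proof (rule antitone_unique[of "\<lambda>r. f (i, r)" m "\<lambda>r. g (i, r)"])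
      show "mset (map (\<lambda>r. f (i, r)) [1..<Suc m]) = mset (map (\<lambda>r. g (i, r)) [1..<Suc m])"
        using be(4)[of i] ga(4)[of i] i nd bg by (simp add: ln m_def del: upt_Suc)
      show "\<And>r. 1 \<le> r \<Longrightarrow> r < m \<Longrightarrow> f (i, r + 1) \<le> f (i, r)"
        using F_setD(4)[OF F i] by (simp add: m_def)
      show "\<And>r. 1 \<le> r \<Longrightarrow> r < m \<Longrightarrow> g (i, r + 1) \<le> g (i, r)"
        using F_setD(4)[OF G, of i] i by (simp add: m_def ln)
    qed (rule r)
    then show ?thesis by (simp add: zi)
  qed
  moreover have "g \<in> I_bnc (conjugate la) \<rightarrow>\<^sub>E UNIV" using F_setD(2)[OF G] ln by simp
  ultimately have "f = g" by (intro PiE_ext[OF F_setD(2)[OF F]])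
  then show "f = g \<and> la = nu" using ln by simp
qed


section \<open>The map \<open>A\<^sup>f\<close>\<close>

lemma take_blocks: "i \<le> l \<Longrightarrow> take (\<Sum>k = 1..i. m k) (blocks l m d) = blocks i m d"
proof (induction l)
  case (Suc l)
  show ?case
  proof (cases "i = Suc l")
    case True
    show ?thesis unfolding True length_blocks[symmetric, of m _ d] by simp
  next
    case False
    then have "i \<le> l" using Suc.prems by simp
    then have "(\<Sum>k = 1..i. m k) \<le> length (blocks l m d)"
      unfolding length_blocks by (intro sum_mono2) auto
    then show ?thesis using Suc.IH[OF \<open>i \<le> l\<close>] by (simp add: blocks_Suc)
  qed
qed simp

lemma blocks_nth:
  assumes "i < l" "t < m (Suc i)"
  shows "blocks l m d ! ((\<Sum>k = 1..i. m k) + t) = d (Suc i)"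
    and "(\<Sum>k = 1..i. m k) + t < length (blocks l m d)"
proof -
  have "(\<Sum>k = 1..Suc i. m k) \<le> (\<Sum>k = 1..l. m k)" using assms by (intro sum_mono2) auto
  then show "(\<Sum>k = 1..i. m k) + t < length (blocks l m d)"
    using assms by (simp add: length_blocks)
  have "blocks l m d ! ((\<Sum>k = 1..i. m k) + t) =
      take (\<Sum>k = 1..Suc i. m k) (blocks l m d) ! ((\<Sum>k = 1..i. m k) + t)"
    using assms by simp
  also have "\<dots> = blocks (Suc i) m d ! (length (blocks i m d) + t)"
    using take_blocks[of "Suc i" l m d] assms by (simp add: length_blocks)
  also have "\<dots> = d (Suc i)" using assms unfolding blocks_Suc nth_append_length_plus by simp
  finally show "blocks l m d ! ((\<Sum>k = 1..i. m k) + t) = d (Suc i)" .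
qed

lemma area_decrease_xc:
  assumes p: "p \<in> dyck n" and q: "q \<in> dyck n" and i: "i \<in> {1..n}" "t \<le> xc p i"
    and xc: "\<And>j. j \<in> {1..n} \<Longrightarrow> xc q j = xc p j - (if j = i then t else 0)"
  shows "area n q = area n p + t"
proof -
  have "(\<Sum>j = 1..n. xc p j) = (\<Sum>j = 1..n. xc q j + (if j = i then t else 0))"
    using xc i by (intro sum.cong) auto
  also have "\<dots> = (\<Sum>j = 1..n. xc q j) + t" using i by (simp add: sum.distrib)
  finally show ?thesis using area_add_sum_xc[OF p] area_add_sum_xc[OF q] by linarith
qed

lemma sum_list_take_mono: "j \<le> k \<Longrightarrow> sum_list (take j xs) \<le> sum_list (take k (xs :: nat list))"
  by (metis le_add1 le_Suc_ex sum_list_append take_add)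

lemma row_idx_eq: "row_idx la i r = row_idx la i 0 + r"
  by (simp add: row_idx_def)

text \<open>Row \<open>row_idx la i 0\<close> is the last row that belongs to a part of size at least \<open>dpart la i\<close>.\<close>

lemma row_idx_partition:
  assumes la: "la \<in> partitions n" and i: "i \<in> {1..<num_dparts la}"
  defines "R \<equiv> \<lambda>i. row_idx la i 0"
  shows "R i + dpart la (i + 1) \<le> R (i + 1)" "R (i + 1) \<le> n" "dpart la i \<le> R i" "1 \<le> R i" "R i \<le> n"
    and "\<exists>k<length la. R i = sum_list (take (Suc k) la) \<and> R i - dpart la i = sum_list (take k la)"
    and "r \<in> {1..dpart la (i + 1)} \<Longrightarrow> xc (comp_path la) (R i + r) = R i"
    and "xc (comp_path la) (R i) = R i - dpart la i"
proof -
  define l m d where "l = num_dparts la" and "m = (\<lambda>k. count_list la (dpart la k))" and "d = dpart la"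
  have bl: "la = blocks l m d"
    using partition_eq_blocks[of la] la by (simp add: partitions_def l_def m_def d_def)
  have mpos: "0 < m k" if "k \<in> {1..l}" for k
    using count_list_dpart_pos[of k la] that by (simp add: m_def l_def)
  have dpos: "0 < d k" if "k \<in> {1..l}" for k
    using dpart_in_set[of k la] that la by (simp add: d_def l_def partitions_def)
  have R: "R k = (\<Sum>j = 1..k. m j * d j)" for k by (simp add: R_def row_idx_def m_def d_def)
  have il: "1 \<le> i" "i < l" using i by (auto simp: l_def)
  then obtain i' where i': "i = Suc i'" by (cases i) auto
  define M where "M k = (\<Sum>j = 1..k. m j)" for k
  have RM: "sum_list (take (M k) la) = R k" if "k \<le> l" for k
    using take_blocks[OF that, of m d] by (simp add: M_def R sum_list_blocks flip: bl)
  show "R i + dpart la (i + 1) \<le> R (i + 1)"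
    using mpos[of "i + 1"] il by (simp add: R d_def)
  have "R (i + 1) \<le> R l" unfolding R using il by (intro sum_mono2) auto
  also have "R l = n"
    using la sum_list_blocks[of l m d] by (simp add: R partitions_def flip: bl)
  finally show Rn: "R (i + 1) \<le> n" .
  then show "R i \<le> n" by (simp add: R)
  show di: "dpart la i \<le> R i"
    using mpos[of i] il by (simp add: R i' d_def trans_le_add2)
  then show "1 \<le> R i" using dpos[of i] il by (simp add: d_def)
  \<comment> \<open>The 0-based position of the last copy of the \<open>i\<close>-th largest
    distinct part.\<close>
  define k where "k = M i - 1"
  have Mi: "M i = M i' + m i" by (simp add: M_def i')
  have mi: "0 < m i" using il by (intro mpos) auto
  have k: "Suc k = M i" "k = M i' + (m i - 1)" using Mi mi by (auto simp: k_def)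
  have kl: "k < length la" "la ! k = d i"
    using blocks_nth[of i' l "m i - 1" m d] il mi k by (simp_all add: i' M_def flip: bl)
  have sk: "sum_list (take k la) + d i = R i"
    using RM[of i] il kl k by (simp add: take_Suc_conv_app_nth flip: k(1))
  have sk': "R i - d i = sum_list (take k la)" using sk by simp
  show "\<exists>k<length la. R i = sum_list (take (Suc k) la) \<and> R i - dpart la i = sum_list (take k la)"
    using kl sk' RM[of i] il k by (intro exI[of _ k]) (simp add: d_def)
  show "xc (comp_path la) (R i) = R i - dpart la i"
    using xc_comp_path[of k la "d i"] kl sk sk' dpos[of i] il by (simp add: d_def)
  show "xc (comp_path la) (R i + r) = R i" if "r \<in> {1..dpart la (i + 1)}"
  proof -
    have "M i < length la" "la ! M i = d (i + 1)"
      using blocks_nth[of i l 0 m d] il mpos[of "i + 1"] by (simp_all add: M_def flip: bl)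
    then show ?thesis using xc_comp_path[of "M i" la r] RM[of i] il that by (simp add: d_def)
  qed
qed

text \<open>Row (i, r) can be lowered by f(i, r) because the row before it leaves room. For
  \<open>r = 1\<close> that row belongs to the preceding part and starts
  \<open>dpart la i > f (i, 1)\<close> units further left, or even more; for \<open>r > 1\<close> it
  was already lowered by f(i, r - 1), which is at least f(i, r). The condition on \<open>zs\<close>
  is inherited by prefixes.\<close>

lemma A_prod_Some:
  assumes F: "(f, la) \<in> F_set n"
  defines "I \<equiv> I_bnc (conjugate la)" and "R \<equiv> \<lambda>i. row_idx la i 0"
  assumes "distinct zs" "set zs \<subseteq> I"
    and "\<forall>us i r vs. zs = us @ (i, r) # vs \<longrightarrow> 1 < r \<longrightarrow> (i, r - 1) \<in> set us"
  shows "\<exists>p\<in>dyck n.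
    op_prod (map (\<lambda>(i, r). A_op n (row_idx la i r) ^^ f (i, r)) zs) (Some (comp_path la)) = Some p \<and>
    (\<forall>j\<in>{1..n}. xc p j \<le> xc (comp_path la) j) \<and>
    (\<forall>(i, r)\<in>I. xc p (row_idx la i r) = R i - (if (i, r) \<in> set zs then f (i, r) else 0)) \<and>
    (\<forall>j\<in>{1..n}. j \<notin> (\<lambda>(i, r). row_idx la i r) ` I \<longrightarrow> xc p j = xc (comp_path la) j) \<and>
    area n p = area n (comp_path la) + sum_list (map f zs)"
  using assms(4-6)
proof (induction zs rule: rev_induct)
  case Nil
  have la: "la \<in> partitions n" by (rule F_setD[OF F])
  have "xc (comp_path la) (row_idx la i r) = R i" if "(i, r) \<in> I" for i r
    using that I_bnc_conjugateD[OF la] row_idx_partition(7)[OF la]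
    unfolding row_idx_eq[of la i r] R_def I_def by blast
  then show ?case
    using comp_path_dyck[OF partitions_compositions[OF la]] by (intro bexI[of _ "comp_path la"]) auto
next
  case (snoc z zs)
  have la: "la \<in> partitions n" by (rule F_setD[OF F])
  have I: "i \<in> {1..<num_dparts la}" "r \<in> {1..dpart la (i + 1)}" "f (i, r) < dpart la i" if "(i, r) \<in> I" for i r
    using that I_bnc_conjugateD[OF la] F_set_less_dpart[OF F] unfolding I_def by blast+
  have mono: "R i \<le> R j" if "i \<le> j" for i j
    unfolding R_def row_idx_def using that by (simp add: sum_mono2)
  have row_bounds: "R i < row_idx la i r" "row_idx la i r \<le> R (i + 1)" "row_idx la i r \<le> n" if "(i, r) \<in> I" for i r
    using I(2)[OF that] row_idx_partition(1,2)[OF la I(1)[OF that]] by (auto simp: row_idx_eq[of la i r] R_def)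
  \<comment> \<open>Rows with first index \<open>i\<close> lie above \<open>R i\<close> and not
    above \<open>R (i + 1)\<close>, so different \<open>i\<close> use disjoint ranges.\<close>
  have inj: "(i, r) = (i', r')" if "(i, r) \<in> I" "(i', r') \<in> I" "row_idx la i r = row_idx la i' r'" for i r i' r'
  proof -
    have "\<not> i < i'" using row_bounds(2)[OF that(1)] row_bounds(1)[OF that(2)] mono[of "i + 1" i'] that(3) by auto
    moreover have "\<not> i' < i" using row_bounds(2)[OF that(2)] row_bounds(1)[OF that(1)] mono[of "i' + 1" i] that(3) by auto
    ultimately show ?thesis using that(3) by (simp add: row_idx_def)
  qed
  obtain i r where z: "z = (i, r)" by force
  have zI: "(i, r) \<in> I" and zn: "(i, r) \<notin> set zs" using snoc.prems by (auto simp: z)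
  let ?j = "row_idx la i r"
  have pre: "\<forall>us i r vs. zs = us @ (i, r) # vs \<longrightarrow> 1 < r \<longrightarrow> (i, r - 1) \<in> set us"
    using snoc.prems(3) by simp
  have "distinct zs" "set zs \<subseteq> I" using snoc.prems(1,2) by auto
  from snoc.IH[OF this pre] obtain p where p: "p \<in> dyck n"
    "op_prod (map (\<lambda>(i, r). A_op n (row_idx la i r) ^^ f (i, r)) zs) (Some (comp_path la)) = Some p"
    "\<forall>j\<in>{1..n}. xc p j \<le> xc (comp_path la) j"
    "\<forall>(i, r)\<in>I. xc p (row_idx la i r) = R i - (if (i, r) \<in> set zs then f (i, r) else 0)"
    "\<forall>j\<in>{1..n}. j \<notin> (\<lambda>(i, r). row_idx la i r) ` I \<longrightarrow> xc p j = xc (comp_path la) j"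
    "area n p = area n (comp_path la) + sum_list (map f zs)" by blast
  note i = I(1)[OF zI] and fd = I(3)[OF zI]
  have j: "?j \<in> {1..n}" using row_bounds[OF zI] by auto
  have xj: "xc p ?j = R i" using p(4) zI zn by fastforce
  have t: "f (i, r) \<le> xc p ?j" using xj fd row_idx_partition(3)[OF la i] by (simp add: R_def)
  have prev: "xc p (?j - 1) + f (i, r) \<le> xc p ?j"
  proof (cases "r = 1")
    case True
    then have "?j - 1 = R i" by (simp add: row_idx_def R_def)
    moreover have "xc p (R i) \<le> R i - dpart la i"
      using p(3) row_idx_partition(4,5,8)[OF la i] by (metis R_def atLeastAtMost_iff)
    ultimately show ?thesis using fd row_idx_partition(3)[OF la i] xj by (simp add: R_def)
  next
    case False
    then have r: "1 < r" using I(2)[OF zI] by auto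
    have "(i, r - 1) \<in> set zs" using snoc.prems(3)[rule_format, of zs i r "[]"] r by (simp add: z)
    moreover from this have rI: "(i, r - 1) \<in> I" using snoc.prems(2) by auto
    ultimately have "xc p (row_idx la i (r - 1)) = R i - f (i, r - 1)" using p(4) by fastforce
    moreover have "row_idx la i (r - 1) = ?j - 1" using r by (simp add: row_idx_def)
    moreover have "f (i, r - 1 + 1) \<le> f (i, r - 1)"
      using zI r conjugate_block_structure(1)[OF la]
      by (intro F_setD(4)[OF F i]) (auto simp: I_def I_bnc_def)
    moreover have "f (i, r - 1) \<le> R i"
      using I(3)[OF rI] row_idx_partition(3)[OF la i] by (simp add: R_def)
    ultimately show ?thesis using r xj by simp
  qed
  obtain q where q: "q \<in> dyck n" "(A_op n ?j ^^ f (i, r)) (Some p) = Some q"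
    "\<forall>k\<in>{1..n}. xc q k = xc p k - (if k = ?j then f (i, r) else 0)"
    using A_op_funpow_Some[OF p(1) j t] prev by blast
  have run: "op_prod (map (\<lambda>(i, r). A_op n (row_idx la i r) ^^ f (i, r)) (zs @ [z])) (Some (comp_path la)) = Some q"
    using p(2) q(2) by (simp add: op_prod_append z)
  have c1: "\<forall>k\<in>{1..n}. xc q k \<le> xc (comp_path la) k"
    using p(3) q(3) le_trans[OF diff_le_self] by simp
  have c2: "xc q (row_idx la i' r') = R i' - (if (i', r') \<in> set (zs @ [z]) then f (i', r') else 0)"
    if "(i', r') \<in> I" for i' r'
  proof -
    have "row_idx la i' r' \<in> {1..n}" using row_bounds[OF that] by auto
    then have "xc q (row_idx la i' r') = xc p (row_idx la i' r') - (if row_idx la i' r' = ?j then f (i, r) else 0)"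
      using q(3) by blast
    moreover have "row_idx la i' r' = ?j \<longleftrightarrow> (i', r') = (i, r)" using inj[OF that zI] by auto
    moreover have "xc p (row_idx la i' r') = R i' - (if (i', r') \<in> set zs then f (i', r') else 0)"
      using p(4) that by blast
    ultimately show ?thesis using zn by (auto simp: z)
  qed
  have c3: "xc q k = xc (comp_path la) k" if "k \<in> {1..n}" "k \<notin> (\<lambda>(i, r). row_idx la i r) ` I" for k
  proof -
    have "k \<noteq> ?j" using that(2) zI by force
    then show ?thesis using q(3) p(5) that by auto
  qed
  have "area n q = area n (comp_path la) + sum_list (map f (zs @ [z]))"
    using area_decrease_xc[OF p(1) q(1) j t] q(3) p(6) by (simp add: z)
  with q(1) run c1 c2 c3 show ?case by (intro bexI[of _ q]) auto
qed

text \<open>A changed row moves from \<open>R i\<close> to \<open>R i - f (i, r)\<close>. Both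
  \<open>R i\<close> and \<open>R i - dpart la i\<close> are consecutive partial sums of
  \<open>la\<close>, and f stays below their difference. So no column in which a bounce step ends is
  affected.\<close>

lemma A_pow_F_set:
  assumes F: "(f, la) \<in> F_set n"
  defines "I \<equiv> I_bnc (conjugate la)" and "R \<equiv> \<lambda>i. row_idx la i 0"
  shows "\<exists>p\<in>dyck n. A_pow n la f = Some p \<and> bounce_comp n p = la \<and>
    area n p = area n (comp_path la) + sum_list (map f (I_bnc_list (conjugate la))) \<and>
    (\<forall>(i, r)\<in>I. f (i, r) \<le> R i \<and> xc p (row_idx la i r) = R i - f (i, r))"
proof -
  have la: "la \<in> partitions n" by (rule F_setD[OF F])
  note lac = partitions_compositions[OF la]
  have fd: "i \<in> {1..<num_dparts la}" "f (i, r) < dpart la i" "dpart la i \<le> R i" if "(i, r) \<in> I" for i r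
  proof -
    show i: "i \<in> {1..<num_dparts la}" using that I_bnc_conjugateD(1)[OF la] by (simp add: I_def)
    show "f (i, r) < dpart la i" using F_set_less_dpart[OF F] that by (simp add: I_def)
    show "dpart la i \<le> R i" unfolding R_def by (rule row_idx_partition(3)[OF la i])
  qed
  let ?zs = "I_bnc_list (conjugate la)"
  have pred: "(i, r - 1) \<in> set us" if eq: "?zs = us @ (i, r) # vs" and r: "1 < r" for us i r vs
  proof -
    have "(i, r) \<in> I_bnc (conjugate la)" using eq by (simp flip: set_I_bnc_list)
    then have "(i, r - 1) \<in> set ?zs" using r by (auto simp: set_I_bnc_list I_bnc_def)
    moreover have "(i, r - 1) \<noteq> (i, r)" using r by simp
    moreover have "(i, r - 1) \<notin> set vs"
      using sorted_I_bnc_list[of "conjugate la"] unfolding eq by (auto simp: sorted_wrt_append lex_less_def)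
    ultimately show ?thesis unfolding eq by auto
  qed
  have "\<exists>p\<in>dyck n. A_pow n la f = Some p \<and>
    (\<forall>j\<in>{1..n}. xc p j \<le> xc (comp_path la) j) \<and>
    (\<forall>(i, r)\<in>I. xc p (row_idx la i r) = R i - (if (i, r) \<in> set ?zs then f (i, r) else 0)) \<and>
    (\<forall>j\<in>{1..n}. j \<notin> (\<lambda>(i, r). row_idx la i r) ` I \<longrightarrow> xc p j = xc (comp_path la) j) \<and>
    area n p = area n (comp_path la) + sum_list (map f ?zs)"
    unfolding A_pow_def I_def R_def
    by (rule A_prod_Some[OF F distinct_I_bnc_list]) (use pred in \<open>auto simp: set_I_bnc_list\<close>)
  then obtain p where p: "p \<in> dyck n" "A_pow n la f = Some p"
    "\<And>i r. (i, r) \<in> I \<Longrightarrow> xc p (row_idx la i r) = R i - f (i, r)"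
    "\<And>j. j \<in> {1..n} \<Longrightarrow> j \<notin> (\<lambda>(i, r). row_idx la i r) ` I \<Longrightarrow> xc p j = xc (comp_path la) j"
    "area n p = area n (comp_path la) + sum_list (map f ?zs)"
    unfolding set_I_bnc_list I_def by fastforce
  note cd = comp_path_dyck[OF lac]
  have "bounce_comp n p = la"
  proof (rule bounce_comp_eqI[OF lac])
    fix k assume k: "k < length la"
    let ?B = "\<lambda>k. sum_list (take k la)"
    have pos: "\<forall>a\<in>set la. 0 < a" and sum: "sum_list la = n" using lac by (auto simp: compositions_def)
    have c: "?B k + 1 \<in> {1..n}" using sum_take_less[OF pos k] sum by simp
    have "ht p (?B k + 1) = ht (comp_path la) (?B k + 1)"
    proof (rule nat_eqI_le)
      fix j assume j: "j \<in> {1..n}"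
      have "xc p j < ?B k + 1 \<longleftrightarrow> xc (comp_path la) j < ?B k + 1"
      proof (cases "j \<in> (\<lambda>(i, r). row_idx la i r) ` I")
        case False
        then show ?thesis using p(4)[OF j] by simp
      next
        case True
        then obtain i r where ir: "(i, r) \<in> I" "j = row_idx la i r" by auto
        note i = fd(1)[OF ir(1)]
        have x0: "xc (comp_path la) j = R i"
          using row_idx_partition(7)[OF la i, of r] I_bnc_conjugateD(2)[OF la, of i r] ir
          by (simp add: row_idx_eq[of la i r] R_def I_def)
        obtain k' where k': "k' < length la" "R i = ?B (Suc k')" "R i - dpart la i = ?B k'"
          using row_idx_partition(6)[OF la i] by (auto simp: R_def)
        \<comment> \<open>The partial sum \<open>?B k\<close> cannot lie strictly between the
          consecutive sums \<open>?B k'\<close> and \<open>?B (Suc k')\<close>.\<close>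
        have "R i \<le> ?B k" if "R i - f (i, r) \<le> ?B k"
        proof (cases "k \<le> k'")
          case True
          then have "?B k \<le> R i - dpart la i" using sum_list_take_mono[of k k' la] k' by simp
          then show ?thesis using that fd(2,3)[OF ir(1)] by linarith
        next
          case False
          then show ?thesis using sum_list_take_mono[of "Suc k'" k la] k' by simp
        qed
        then show ?thesis using x0 p(3)[OF ir(1)] ir(2) by auto
      qed
      then show "j \<le> ht p (?B k + 1) \<longleftrightarrow> j \<le> ht (comp_path la) (?B k + 1)"
        using dyck_galois[OF p(1) c j] dyck_galois[OF cd c j] by simp
    qed (use c ht_le[OF p(1)] ht_le[OF cd] in auto)
    also have "\<dots> = ?B (Suc k)" using ht_comp_path[of k la 1] k pos by (simp add: Suc_le_eq)
    finally show "ht p (?B k + 1) = ?B (Suc k)" .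
  qed
  moreover have "f (i, r) \<le> R i" if "(i, r) \<in> I" for i r
    using fd(2,3)[OF that] by linarith
  ultimately show ?thesis using p by (intro bexI[of _ p]) auto
qed

lemma inj_on_A_pow: "inj_on (\<lambda>(f, la). A_pow n la f) (F_set n)"
proof (rule inj_onI, clarify)
  fix f la g nu assume F: "(f, la) \<in> F_set n" and G: "(g, nu) \<in> F_set n" and eq: "A_pow n la f = A_pow n nu g"
  obtain p where p: "A_pow n la f = Some p" "bounce_comp n p = la"
    "\<forall>(i, r)\<in>I_bnc (conjugate la). f (i, r) \<le> row_idx la i 0 \<and> xc p (row_idx la i r) = row_idx la i 0 - f (i, r)"
    using A_pow_F_set[OF F] by blast
  obtain q where q: "A_pow n nu g = Some q" "bounce_comp n q = nu"
    "\<forall>(i, r)\<in>I_bnc (conjugate nu). g (i, r) \<le> row_idx nu i 0 \<and> xc q (row_idx nu i r) = row_idx nu i 0 - g (i, r)"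
    using A_pow_F_set[OF G] by blast
  have pq: "p = q" using eq p(1) q(1) by simp
  then have ln: "la = nu" using p(2) q(2) by simp
  have "f z = g z" if "z \<in> I_bnc (conjugate la)" for z
  proof -
    obtain i r where z: "z = (i, r)" by force
    \<comment> \<open>The bound keeps the subtraction from truncating, so the row coordinate
      determines the value of the count map.\<close>
    have "f (i, r) \<le> row_idx la i 0" "xc p (row_idx la i r) = row_idx la i 0 - f (i, r)"
      using p(3) that z by blast+
    moreover have "g (i, r) \<le> row_idx la i 0" "xc p (row_idx la i r) = row_idx la i 0 - g (i, r)"
      using q(3) that z ln pq by blast+
    ultimately show ?thesis by (simp add: z)
  qed
  moreover have "g \<in> I_bnc (conjugate la) \<rightarrow>\<^sub>E UNIV" using F_setD(2)[OF G] ln by simp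
  ultimately have "f = g" by (intro PiE_ext[OF F_setD(2)[OF F]])
  then show "f = g \<and> la = nu" using ln by simp
qed

lemma area_bounce_exchange:
  assumes F: "(f, la) \<in> F_set n" and n: "1 \<le> n"
  shows "\<exists>p\<in>dyck n. \<exists>q\<in>dyck n. A_pow n la f = Some p \<and> B_sub n la f = Some q \<and>
    area n q = bounce n p \<and> bounce n q = area n p"
proof -
  let ?mu = "conjugate la"
  have la: "la \<in> partitions n" by (rule F_setD[OF F])
  have mu: "?mu \<in> partitions n" by (rule conjugate_partitions[OF la])
  obtain p where p: "p \<in> dyck n" "A_pow n la f = Some p" "bounce_comp n p = la"
    "area n p = area n (comp_path la) + sum_list (map f (I_bnc_list ?mu))"
    using A_pow_F_set[OF F] by blast
  obtain be where be: "be \<in> compositions n" "B_sub n la f = Some (comp_path be)"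
    "comp_bounce be = comp_bounce ?mu + sum_list (map f (I_bnc_list ?mu))"
    "area n (comp_path be) = area n (comp_path ?mu)"
    using B_sub_F_set[OF F n] by blast
  note q = comp_path_dyck[OF be(1)]
  have "2 * comp_bounce la + n = sq_sum ?mu"
    using two_comp_bounce_eq_sq_sum_conjugate[of la] la by (simp add: partitions_def)
  then have "area n (comp_path be) = bounce n p"
    using two_area_comp_path[OF partitions_compositions[OF mu]] be(4) bounce_eq_comp_bounce[OF p(1)] p(3)
    by simp
  moreover have "2 * comp_bounce ?mu + n = sq_sum la"
    using two_comp_bounce_eq_sq_sum_conjugate[of ?mu] mu conjugate_conjugate[OF la]
    by (simp add: partitions_def)
  then have "bounce n (comp_path be) = area n p"
    using two_area_comp_path[OF partitions_compositions[OF la]] be(3) p(4)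
      bounce_eq_comp_bounce[OF q] bounce_comp_comp_path[OF be(1)] by simp
  ultimately show ?thesis using p(1,2) be(2) q by blast
qed

theorem theorem3p9:
  fixes n :: nat
  assumes "1 \<le> n"
  shows "\<exists>\<Phi>. bij_betw \<Phi> (AF n) (BF n) \<and>
           (\<forall>(f, la)\<in>F_set n. \<Phi> (A_pow n la f) = B_sub n la f) \<and>
           (\<forall>z\<in>AF n. \<exists>p\<in>dyck n. \<exists>q\<in>dyck n. z = Some p \<and> \<Phi> z = Some q \<and>
              area n q = bounce n p \<and> bounce n q = area n p)"
proof -
  define A where "A = (\<lambda>(f, la). A_pow n la f)"
  define B where "B = (\<lambda>(f, la). B_sub n la f)"
  define \<Phi> where "\<Phi> = B \<circ> inv_into (F_set n) A"
  have injA: "inj_on A (F_set n)" unfolding A_def by (rule inj_on_A_pow)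
  have injB: "inj_on B (F_set n)" unfolding B_def by (rule inj_on_B_sub[OF assms])
  have AF: "AF n = A ` F_set n" by (force simp: AF_def A_def)
  have BF: "BF n = B ` F_set n" by (force simp: BF_def B_def)
  have \<Phi>: "\<Phi> (A x) = B x" if "x \<in> F_set n" for x
    using inv_into_f_f[OF injA that] by (simp add: \<Phi>_def)
  have "bij_betw \<Phi> (AF n) (BF n)"
    unfolding AF BF \<Phi>_def
    using injA injB by (intro bij_betw_trans[OF bij_betw_inv_into]) (auto simp: bij_betw_def)
  moreover have "\<forall>(f, la)\<in>F_set n. \<Phi> (A_pow n la f) = B_sub n la f"
    using \<Phi> by (auto simp: A_def B_def)
  moreover have "\<exists>p\<in>dyck n. \<exists>q\<in>dyck n. z = Some p \<and> \<Phi> z = Some q \<and>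
      area n q = bounce n p \<and> bounce n q = area n p" if "z \<in> AF n" for z
  proof -
    obtain f la where F: "(f, la) \<in> F_set n" "z = A (f, la)" using \<open>z \<in> AF n\<close> AF by force
    then show ?thesis using area_bounce_exchange[OF F(1) assms] \<Phi>[OF F(1)] by (simp add: A_def B_def)
  qed
  ultimately show ?thesis by blast
qed

end
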